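(* Let $\eta,\eta'>0$ and let $Y$, $Y'$ be block subdiagonal matrices with block sizes $d_0,\dots,d_m$ and $d_0',\dots,d_{m'}'$ respectively. The multiplication operators $M$ on $\mathcal H_I^{(\eta,Y)}$ and on $\mathcal H_I^{(\eta',Y')}$ are similar if and only if the blocks in $Y$ and $Y'$ are of the same size (that is, $m=m'$ and $d_j=d_j'$ for $0\le j\le m$) and $\eta=\eta'$.
   Context: Let $\mathbb D$ be the unit disc. Data: $m\ge 0$, $d_0,\dots,d_m\ge1$, $d=d_0+\cdots+d_m$, $\mathbb C^d=\bigoplus_{j=0}^m\mathbb C^{d_j}$. $Y$ is the $d\times d$ block matrix whose only nonzero blocks are $Y_j:\mathbb C^{d_{j-1}}\to\mathbb C^{d_j}$ in position $(j,j-1)$, $1\le j\le m$ (arbitrary matrices). For $\lambda>0$, $\mathbb A^{(\lambda)}$ is the Hilbert space of holomorphic functions on $\mathbb D$ with reproducing kernel $(1-z\bar w)^{-2\lambda}$. For $\eta>0$, $\mathbf A^{(\eta)}=\bigoplus_{j=0}^m\mathbb A^{(\eta+j)}\otimes\mathbb C^{d_j}$, viewed as a space of functions $f=(f_0,\dots,f_m):\mathbb D\to\mathbb C^d$. With $(x)_n=x(x+1)\cdots(x+n-1)$, $(x)_0=1$, define $$(\Gamma^{(\eta,Y)}f)_\ell=\sum_{j=0}^{\ell}\frac{1}{(\ell-j)!}\frac{1}{(2\eta+2j)_{\ell-j}}\,Y_\ell\cdots Y_{j+1}\,f_j^{(\ell-j)},\qquad 0\le\ell\le m$$ (empty products of matrices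 are identities). $\mathcal H_I^{(\eta,Y)}$ is the image $\Gamma^{(\eta,Y)}(\mathbf A^{(\eta)})$ in the space of holomorphic functions $\mathbb D\to\mathbb C^d$, normed so that the (injective) map $\Gamma^{(\eta,Y)}$ is a Hilbert space isometry. $M$ is the bounded operator $(Mf)(z)=zf(z)$. Operators $T,T'$ on Hilbert spaces are similar if $LT=T'L$ for some bounded invertible linear map $L$ between the spaces. *)

theory Defs
  imports "HOL-Complex_Analysis.Complex_Analysis" "Jordan_Normal_Form.Matrix"
begin

text \<open>
  Hilbert spaces of complex functions on a set \<open>X\<close>, with pointwise linear operations. Elements
  are total functions on the ambient type that vanish off \<open>X\<close>, and the inner product (linear in
  its first argument) is set to 0 outside the carrier; with these normalisations a space is
  determined by its mathematical content.
\<close>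

record 'x fun_space =
  elems :: "('x \<Rightarrow> complex) set"
  ip :: "('x \<Rightarrow> complex) \<Rightarrow> ('x \<Rightarrow> complex) \<Rightarrow> complex"

definition hnorm :: "'x fun_space \<Rightarrow> ('x \<Rightarrow> complex) \<Rightarrow> real" where
  "hnorm S f = sqrt (Re (ip S f f))"

definition hilbert_fun_space :: "'x set \<Rightarrow> 'x fun_space \<Rightarrow> bool" where
  "hilbert_fun_space X S \<longleftrightarrow>
     (\<forall>f\<in>elems S. \<forall>x. x \<notin> X \<longrightarrow> f x = 0) \<and>
     (\<forall>f g. f \<notin> elems S \<or> g \<notin> elems S \<longrightarrow> ip S f g = 0) \<and>
     (\<lambda>x. 0) \<in> elems S \<and>
     (\<forall>f\<in>elems S. \<forall>g\<in>elems S. (\<lambda>x. f x + g x) \<in> elems S) \<and>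
     (\<forall>c. \<forall>f\<in>elems S. (\<lambda>x. c * f x) \<in> elems S) \<and>
     (\<forall>f\<in>elems S. \<forall>g\<in>elems S. \<forall>h\<in>elems S.
        ip S (\<lambda>x. f x + g x) h = ip S f h + ip S g h) \<and>
     (\<forall>c. \<forall>f\<in>elems S. \<forall>g\<in>elems S. ip S (\<lambda>x. c * f x) g = c * ip S f g) \<and>
     (\<forall>f\<in>elems S. \<forall>g\<in>elems S. ip S g f = cnj (ip S f g)) \<and>
     (\<forall>f\<in>elems S. 0 \<le> Re (ip S f f) \<and> (ip S f f = 0 \<longrightarrow> f = (\<lambda>x. 0))) \<and>
     (\<forall>s. (\<forall>n::nat. s n \<in> elems S) \<and>
          (\<forall>e>0. \<exists>N. \<forall>p\<ge>N. \<forall>q\<ge>N. hnorm S (\<lambda>x. s p x - s q x) < e) \<longrightarrow>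
          (\<exists>f\<in>elems S. (\<lambda>n. hnorm S (\<lambda>x. s n x - f x)) \<longlonglongrightarrow> 0))"

definition has_reproducing_kernel ::
    "'x set \<Rightarrow> ('x \<Rightarrow> 'x \<Rightarrow> complex) \<Rightarrow> 'x fun_space \<Rightarrow> bool" where
  "has_reproducing_kernel X K S \<longleftrightarrow>
     (\<forall>w\<in>X. (\<lambda>z. if z \<in> X then K z w else 0) \<in> elems S \<and>
        (\<forall>f\<in>elems S. f w = ip S f (\<lambda>z. if z \<in> X then K z w else 0)))"

definition unit_disc :: "complex set" where
  "unit_disc = ball 0 1"

text \<open>
  The principal branch of the power is the intended one, since \<open>Re (1 - z * cnj w) > 0\<close> on the
  disc. A reproducing kernel determines its Hilbert space, hence the definite description.
\<close>

definition bergman :: "real \<Rightarrow> complex fun_space" where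
  "bergman a = (THE S. hilbert_fun_space unit_disc S \<and>
     (\<forall>f\<in>elems S. f holomorphic_on unit_disc) \<and>
     has_reproducing_kernel unit_disc (\<lambda>z w. (1 - z * cnj w) powr (- 2 * of_real a)) S)"

text \<open>
  A function \<open>F\<close> from the disc to \<open>\<complex>\<^sup>d = \<Oplus>\<^sub>j \<complex>\<^bsup>d j\<^esup>\<close>, \<open>j \<le> m\<close>, is represented by its scalar
  components: \<open>F (z, j, i)\<close> is the coordinate \<open>i < d j\<close> of the block \<open>F\<^sub>j z\<close>. Thus
  \<open>\<bbbA>\<^bsup>(\<eta>+j)\<^esup> \<otimes> \<complex>\<^bsup>d j\<^esup>\<close> is the orthogonal sum of \<open>d j\<close> copies of \<open>\<bbbA>\<^bsup>(\<eta>+j)\<^esup>\<close>.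
\<close>

type_synonym vec_fun = "complex \<times> nat \<times> nat \<Rightarrow> complex"

definition sum_bergman :: "real \<Rightarrow> nat \<Rightarrow> (nat \<Rightarrow> nat) \<Rightarrow> (complex \<times> nat \<times> nat) fun_space" where
  "sum_bergman \<eta> m d =
     (let H = {F. (\<forall>z j i. \<not> (j \<le> m \<and> i < d j) \<longrightarrow> F (z, j, i) = 0) \<and>
                  (\<forall>j\<le>m. \<forall>i<d j. (\<lambda>z. F (z, j, i)) \<in> elems (bergman (\<eta> + real j)))}
      in \<lparr> elems = H,
           ip = (\<lambda>F G. if F \<in> H \<and> G \<in> H
             then \<Sum>j\<le>m. \<Sum>i<d j.
               ip (bergman (\<eta> + real j)) (\<lambda>z. F (z, j, i)) (\<lambda>z. G (z, j, i))
             else 0) \<rparr>)"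

definition block :: "(nat \<Rightarrow> nat) \<Rightarrow> complex mat \<Rightarrow> nat \<Rightarrow> nat \<Rightarrow> complex mat" where
  "block d Y p q = Matrix.mat (d p) (d q) (\<lambda>(r, s). Y $$ ((\<Sum>k<p. d k) + r, (\<Sum>k<q. d k) + s))"

definition block_subdiagonal :: "nat \<Rightarrow> (nat \<Rightarrow> nat) \<Rightarrow> complex mat \<Rightarrow> bool" where
  "block_subdiagonal m d Y \<longleftrightarrow>
     Y \<in> carrier_mat (\<Sum>k\<le>m. d k) (\<Sum>k\<le>m. d k) \<and>
     (\<forall>p\<le>m. \<forall>q\<le>m. p \<noteq> Suc q \<longrightarrow> block d Y p q = 0\<^sub>m (d p) (d q))"

text \<open>\<open>block_prod d Y j k\<close> is the product \<open>Y\<^bsub>j+k\<^esub> \<cdots> Y\<^bsub>j+1\<^esub>\<close>.\<close>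

primrec block_prod :: "(nat \<Rightarrow> nat) \<Rightarrow> complex mat \<Rightarrow> nat \<Rightarrow> nat \<Rightarrow> complex mat" where
  "block_prod d Y j 0 = 1\<^sub>m (d j)"
| "block_prod d Y j (Suc k) = block d Y (Suc (j + k)) (j + k) * block_prod d Y j k"

definition Gamma_map ::
    "real \<Rightarrow> nat \<Rightarrow> (nat \<Rightarrow> nat) \<Rightarrow> complex mat \<Rightarrow> vec_fun \<Rightarrow> vec_fun" where
  "Gamma_map \<eta> m d Y F = (\<lambda>(z, l, r).
     if z \<in> unit_disc \<and> l \<le> m \<and> r < d l then
       \<Sum>j\<le>l. 1 / fact (l - j) *
         (1 / pochhammer (complex_of_real (2 * \<eta> + 2 * real j)) (l - j)) *
         (\<Sum>s<d j. block_prod d Y j (l - j) $$ (r, s) *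
            (deriv ^^ (l - j)) (\<lambda>w. F (w, j, s)) z)
     else 0)"

definition H_I ::
    "real \<Rightarrow> nat \<Rightarrow> (nat \<Rightarrow> nat) \<Rightarrow> complex mat \<Rightarrow> (complex \<times> nat \<times> nat) fun_space" where
  "H_I \<eta> m d Y =
     (let A = sum_bergman \<eta> m d; \<Gamma> = Gamma_map \<eta> m d Y; H = \<Gamma> ` elems A
      in \<lparr> elems = H,
           ip = (\<lambda>F G. if F \<in> H \<and> G \<in> H
             then ip A (inv_into (elems A) \<Gamma> F) (inv_into (elems A) \<Gamma> G) else 0) \<rparr>)"

definition mult_op :: "vec_fun \<Rightarrow> vec_fun" where
  "mult_op F = (\<lambda>(z, j, i). z * F (z, j, i))"

definition bounded_linear_map ::
    "'x fun_space \<Rightarrow> 'y fun_space \<Rightarrow> (('x \<Rightarrow> complex) \<Rightarrow> 'y \<Rightarrow> complex) \<Rightarrow> bool" where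
  "bounded_linear_map S S' L \<longleftrightarrow>
     (\<forall>f\<in>elems S. L f \<in> elems S') \<and>
     (\<forall>f\<in>elems S. \<forall>g\<in>elems S. L (\<lambda>x. f x + g x) = (\<lambda>y. L f y + L g y)) \<and>
     (\<forall>c. \<forall>f\<in>elems S. L (\<lambda>x. c * f x) = (\<lambda>y. c * L f y)) \<and>
     (\<exists>C. \<forall>f\<in>elems S. hnorm S' (L f) \<le> C * hnorm S f)"

text \<open>Similarity is a relation between bounded operators, so it includes their boundedness.\<close>

definition similar_ops ::
    "'x fun_space \<Rightarrow> (('x \<Rightarrow> complex) \<Rightarrow> 'x \<Rightarrow> complex) \<Rightarrow>
     'y fun_space \<Rightarrow> (('y \<Rightarrow> complex) \<Rightarrow> 'y \<Rightarrow> complex) \<Rightarrow> bool" where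
  "similar_ops S T S' T' \<longleftrightarrow>
     bounded_linear_map S S T \<and> bounded_linear_map S' S' T' \<and>
     (\<exists>L L'. bounded_linear_map S S' L \<and> bounded_linear_map S' S L' \<and>
        (\<forall>f\<in>elems S. L' (L f) = f) \<and> (\<forall>g\<in>elems S'. L (L' g) = g) \<and>
        (\<forall>f\<in>elems S. L (T f) = T' (L f)))"

end

theory Submission
  imports Defs
begin

text \<open>
  The proof removes \<open>Y\<close> first and then reads off the block sizes from the growth of the powers of
  the multiplication operator.

  Differentiating \<open>k\<close> times maps the space with kernel index \<open>a\<close> boundedly into the one with index
  \<open>a + k\<close>. Hence the operator \<open>\<Gamma>\<close> maps the orthogonal sum \<open>sum_bergman \<eta> m d\<close> boundedly into
  itself, and there it is block lower triangular with identities on the diagonal. By forward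
  substitution it is onto and bounded below, so \<open>H_I \<eta> m d Y\<close> is the orthogonal sum itself with an
  equivalent norm (\<open>H_I_norm_equiv\<close>), and the identity map shows that the multiplication operators
  on \<open>H_I \<eta> m d Y\<close> and on \<open>sum_bergman \<eta> m d\<close> are similar. This proves one direction and reduces
  the other to the orthogonal sums.

  Let \<open>L\<close> intertwine the multiplication operators of two such sums. Since \<open>L\<close> commutes with
  multiplication by \<open>z\<close>, the value of \<open>L F\<close> at the origin is a matrix \<open>P\<close> applied to the value of
  \<open>F\<close> at the origin (\<open>value_at_0\<close>), and the inverse of \<open>L\<close> gives the inverse matrix. The squared
  norm of \<open>z ^ n\<close> in a summand of index \<open>a\<close> is of order \<open>n powr (1 - 2 * a)\<close>. Comparing the norms of
  \<open>z ^ n\<close> times a constant vector and of its image for large \<open>n\<close>, an entry of \<open>P\<close> from a summand of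
  index \<open>a\<close> to one of index \<open>b\<close> can only be nonzero if \<open>a \<le> b\<close> (\<open>value_nonzero_imp_le\<close>), and the same
  holds for the inverse matrix. Taking the trace of the product over the coordinates of a single
  index shows that both sums have the same number of summands of each index (\<open>card_levels_eq\<close>), and
  these numbers determine \<open>\<eta>\<close>, \<open>m\<close> and the \<open>d j\<close>.

  All of this uses the concrete description of \<open>bergman a\<close> as a weighted space of Taylor
  coefficients, where \<open>z ^ n\<close> has squared norm \<open>n! / (2 a)\<^sub>n\<close>. That space is a Hilbert space with the
  required kernel, and a reproducing kernel determines its space.
\<close>

section \<open>A reproducing kernel determines its Hilbert space\<close>

locale hfs =
  fixes X :: "'x set" and S :: "'x fun_space"
  assumes hilbert: "hilbert_fun_space X S"
begin

lemmas hilbert_conjs = hilbert[unfolded hilbert_fun_space_def]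

lemma off_carrier: "f \<in> elems S \<Longrightarrow> x \<notin> X \<Longrightarrow> f x = 0"
  and ip_off: "f \<notin> elems S \<or> g \<notin> elems S \<Longrightarrow> ip S f g = 0"
  and zero_mem: "(\<lambda>x. 0) \<in> elems S"
  and add_mem: "f \<in> elems S \<Longrightarrow> g \<in> elems S \<Longrightarrow> (\<lambda>x. f x + g x) \<in> elems S"
  and scale_mem: "f \<in> elems S \<Longrightarrow> (\<lambda>x. c * f x) \<in> elems S"
  and ip_add_left: "f \<in> elems S \<Longrightarrow> g \<in> elems S \<Longrightarrow> h \<in> elems S \<Longrightarrow>
        ip S (\<lambda>x. f x + g x) h = ip S f h + ip S g h"
  and ip_scale_left: "f \<in> elems S \<Longrightarrow> g \<in> elems S \<Longrightarrow>
        ip S (\<lambda>x. c * f x) g = c * ip S f g"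
  and ip_sym: "f \<in> elems S \<Longrightarrow> g \<in> elems S \<Longrightarrow> ip S g f = cnj (ip S f g)"
  and ip_nonneg: "f \<in> elems S \<Longrightarrow> 0 \<le> Re (ip S f f)"
  and ip_definite: "f \<in> elems S \<Longrightarrow> ip S f f = 0 \<Longrightarrow> f = (\<lambda>x. 0)"
  and complete: "(\<And>n::nat. s n \<in> elems S) \<Longrightarrow>
        (\<And>e. e > 0 \<Longrightarrow> \<exists>N. \<forall>p\<ge>N. \<forall>q\<ge>N. hnorm S (\<lambda>x. s p x - s q x) < e) \<Longrightarrow>
        \<exists>f\<in>elems S. (\<lambda>n. hnorm S (\<lambda>x. s n x - f x)) \<longlonglongrightarrow> 0"
  subgoal using hilbert_conjs[THEN conjunct1] by simp
  subgoal using hilbert_conjs[THEN conjunct2, THEN conjunct1] by simp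
  subgoal using hilbert_conjs[THEN conjunct2, THEN conjunct2, THEN conjunct1] .
  subgoal using hilbert_conjs[THEN conjunct2, THEN conjunct2, THEN conjunct2, THEN conjunct1] by simp
  subgoal using hilbert_conjs[THEN conjunct2, THEN conjunct2, THEN conjunct2, THEN conjunct2,
        THEN conjunct1] by simp
  subgoal using hilbert_conjs[THEN conjunct2, THEN conjunct2, THEN conjunct2, THEN conjunct2,
        THEN conjunct2, THEN conjunct1] by simp
  subgoal using hilbert_conjs[THEN conjunct2, THEN conjunct2, THEN conjunct2, THEN conjunct2,
        THEN conjunct2, THEN conjunct2, THEN conjunct1] by simp
  subgoal using hilbert_conjs[THEN conjunct2, THEN conjunct2, THEN conjunct2, THEN conjunct2,
        THEN conjunct2, THEN conjunct2, THEN conjunct2, THEN conjunct1] by blast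
  subgoal using hilbert_conjs[THEN conjunct2, THEN conjunct2, THEN conjunct2, THEN conjunct2,
        THEN conjunct2, THEN conjunct2, THEN conjunct2, THEN conjunct2, THEN conjunct1] by simp
  subgoal using hilbert_conjs[THEN conjunct2, THEN conjunct2, THEN conjunct2, THEN conjunct2,
        THEN conjunct2, THEN conjunct2, THEN conjunct2, THEN conjunct2, THEN conjunct1] by simp
  subgoal using hilbert_conjs[THEN conjunct2, THEN conjunct2, THEN conjunct2, THEN conjunct2,
        THEN conjunct2, THEN conjunct2, THEN conjunct2, THEN conjunct2, THEN conjunct2] by simp
  done

lemma diff_mem: "f \<in> elems S \<Longrightarrow> g \<in> elems S \<Longrightarrow> (\<lambda>x. f x - g x) \<in> elems S"
  using add_mem[OF _ scale_mem[of g "-1"], of f] by simp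

lemma ip_add_right:
  assumes "f \<in> elems S" "g \<in> elems S" "h \<in> elems S"
  shows "ip S h (\<lambda>x. f x + g x) = ip S h f + ip S h g"
  using assms by (simp add: ip_sym[of _ h] add_mem ip_add_left)

lemma ip_scale_right:
  assumes "f \<in> elems S" "g \<in> elems S"
  shows "ip S g (\<lambda>x. c * f x) = cnj c * ip S g f"
  using assms by (simp add: ip_sym[of _ g] scale_mem ip_scale_left)

lemma ip_diff_left:
  assumes "f \<in> elems S" "g \<in> elems S" "h \<in> elems S"
  shows "ip S (\<lambda>x. f x - g x) h = ip S f h - ip S g h"
  using ip_add_left[OF assms(1) scale_mem[of g "-1"] assms(3)] ip_scale_left[of g h "-1"] assms
  by simp

lemma hnorm_nonneg: "0 \<le> hnorm S f"
  using ip_nonneg[of f] ip_off[of f f] by (cases "f \<in> elems S") (auto simp: hnorm_def)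

lemma ip_self: "f \<in> elems S \<Longrightarrow> ip S f f = of_real ((hnorm S f)\<^sup>2)"
  using ip_sym[of f f] ip_nonneg[of f] by (simp add: hnorm_def complex_eq_iff)

lemma hnorm_eq_0: "f \<in> elems S \<Longrightarrow> hnorm S f = 0 \<Longrightarrow> f = (\<lambda>x. 0)"
  using ip_self[of f] ip_definite[of f] by simp

lemma ip_zero_right: "f \<in> elems S \<Longrightarrow> ip S f (\<lambda>x. 0) = 0"
  using ip_scale_right[of "\<lambda>x. 0" f 0] zero_mem by simp

lemma hnorm_scale: "f \<in> elems S \<Longrightarrow> hnorm S (\<lambda>x. c * f x) = cmod c * hnorm S f"
proof -
  assume f: "f \<in> elems S"
  have "ip S (\<lambda>x. c * f x) (\<lambda>x. c * f x) = (c * cnj c) * ip S f f"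
    using f by (simp add: ip_scale_left ip_scale_right scale_mem)
  also have "\<dots> = of_real ((cmod c)\<^sup>2 * (hnorm S f)\<^sup>2)"
    by (simp add: ip_self[OF f] complex_norm_square[symmetric])
  finally have "(hnorm S (\<lambda>x. c * f x))\<^sup>2 = (cmod c * hnorm S f)\<^sup>2"
    using ip_self[OF scale_mem[OF f, of c]]
    by (metis of_real_eq_iff power_mult_distrib)
  then show ?thesis
    using hnorm_nonneg by (simp add: power2_eq_iff_nonneg)
qed

lemma hnorm_diff_commute:
  assumes "f \<in> elems S" "g \<in> elems S"
  shows "hnorm S (\<lambda>x. f x - g x) = hnorm S (\<lambda>x. g x - f x)"
  using hnorm_scale[OF diff_mem[OF assms], of "-1"] by simp

lemma hnorm_expand:
  assumes f: "f \<in> elems S" and g: "g \<in> elems S"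
  shows "(hnorm S (\<lambda>x. f x + c * g x))\<^sup>2 =
    (hnorm S f)\<^sup>2 + 2 * Re (cnj c * ip S f g) + (cmod c)\<^sup>2 * (hnorm S g)\<^sup>2"
proof -
  have cg: "(\<lambda>x. c * g x) \<in> elems S" by (rule scale_mem[OF g])
  have "complex_of_real ((hnorm S (\<lambda>x. f x + c * g x))\<^sup>2) =
      ip S f f + ip S f (\<lambda>x. c * g x) + (ip S (\<lambda>x. c * g x) f + ip S (\<lambda>x. c * g x) (\<lambda>x. c * g x))"
    using f cg by (simp only: ip_self[symmetric] add_mem ip_add_left ip_add_right)
  also have "ip S f (\<lambda>x. c * g x) = cnj c * ip S f g"
    by (rule ip_scale_right[OF g f])
  also have "ip S (\<lambda>x. c * g x) f = cnj (cnj c * ip S f g)"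
    using ip_sym[OF f cg] ip_scale_right[OF g f, of c] by simp
  also have "ip S (\<lambda>x. c * g x) (\<lambda>x. c * g x) = of_real ((cmod c)\<^sup>2 * (hnorm S g)\<^sup>2)"
    by (simp add: ip_self[OF cg] hnorm_scale[OF g] power_mult_distrib)
  finally show ?thesis
    by (simp add: ip_self[OF f] complex_eq_iff)
qed

lemma Cauchy_Schwarz:
  assumes f: "f \<in> elems S" and g: "g \<in> elems S"
  shows "cmod (ip S f g) \<le> hnorm S f * hnorm S g"
proof (cases "hnorm S g = 0")
  case True
  then show ?thesis using hnorm_eq_0[OF g] ip_zero_right[OF f] by simp
next
  case False
  define a where "a = ip S f g"
  define N where "N = (hnorm S g)\<^sup>2"
  have N: "N > 0" using False by (simp add: N_def)
  \<comment> \<open>The scalar for which \<open>f + c g\<close> has least norm.\<close>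
  define c where "c = - a / of_real N"
  have c: "cnj c * a = - of_real ((cmod a)\<^sup>2 / N)"
    using complex_norm_square[of a] by (simp add: c_def mult.commute)
  have cc: "(cmod c)\<^sup>2 * N = (cmod a)\<^sup>2 / N"
    using N by (simp add: c_def norm_divide power_divide power2_eq_square field_simps)
  have "0 \<le> (hnorm S (\<lambda>x. f x + c * g x))\<^sup>2" by simp
  also have "\<dots> = (hnorm S f)\<^sup>2 + 2 * Re (cnj c * a) + (cmod c)\<^sup>2 * N"
    unfolding N_def a_def by (rule hnorm_expand[OF f g])
  also have "\<dots> = (hnorm S f)\<^sup>2 - (cmod a)\<^sup>2 / N"
    unfolding c cc by simp
  finally have "(cmod a)\<^sup>2 \<le> (hnorm S f)\<^sup>2 * N"
    using N by (simp add: field_simps)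
  then have "(cmod a)\<^sup>2 \<le> (hnorm S f * hnorm S g)\<^sup>2"
    by (simp add: N_def power_mult_distrib)
  then show ?thesis
    unfolding a_def by (rule power2_le_imp_le) (simp add: hnorm_nonneg)
qed

lemma hnorm_triangle:
  assumes f: "f \<in> elems S" and g: "g \<in> elems S"
  shows "hnorm S (\<lambda>x. f x + g x) \<le> hnorm S f + hnorm S g"
proof (rule power2_le_imp_le)
  have "(hnorm S (\<lambda>x. f x + g x))\<^sup>2 = (hnorm S f)\<^sup>2 + 2 * Re (ip S f g) + (hnorm S g)\<^sup>2"
    using hnorm_expand[OF f g, of 1] by simp
  also have "Re (ip S f g) \<le> hnorm S f * hnorm S g"
    using Cauchy_Schwarz[OF f g] complex_Re_le_cmod order_trans by blast
  finally show "(hnorm S (\<lambda>x. f x + g x))\<^sup>2 \<le> (hnorm S f + hnorm S g)\<^sup>2"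
    by (simp add: power2_sum)
qed (simp add: hnorm_nonneg)

lemma hnorm_triangle_diff:
  assumes "f \<in> elems S" "g \<in> elems S" "h \<in> elems S"
  shows "hnorm S (\<lambda>x. f x - h x) \<le> hnorm S (\<lambda>x. f x - g x) + hnorm S (\<lambda>x. g x - h x)"
  using hnorm_triangle[OF diff_mem[OF assms(1,2)] diff_mem[OF assms(2,3)]] by simp

lemma sum_mem_hnorm_le:
  assumes "finite A" and "\<And>a. a \<in> A \<Longrightarrow> f a \<in> elems S"
  shows "(\<lambda>x. \<Sum>a\<in>A. f a x) \<in> elems S \<and> hnorm S (\<lambda>x. \<Sum>a\<in>A. f a x) \<le> (\<Sum>a\<in>A. hnorm S (f a))"
  using assms
proof (induction A rule: finite_induct)
  case empty
  show ?case using zero_mem hnorm_scale[OF zero_mem, of 0] by simp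
next
  case (insert a A)
  then show ?case
    using add_mem[of "f a" "\<lambda>x. \<Sum>a\<in>A. f a x"] hnorm_triangle[of "f a" "\<lambda>x. \<Sum>a\<in>A. f a x"]
    by auto
qed

text \<open>
  Any sequence in \<open>D\<close> that minimises the distance to \<open>f\<close> is Cauchy by the parallelogram law, and
  the defects \<open>f - s n\<close> become orthogonal to \<open>D\<close>.
\<close>

lemma projection:
  assumes D: "D \<subseteq> elems S" and D0: "(\<lambda>x. 0) \<in> D"
    and Dadd: "\<And>g h c. g \<in> D \<Longrightarrow> h \<in> D \<Longrightarrow> (\<lambda>x. g x + c * h x) \<in> D"
    and f: "f \<in> elems S"
  shows "\<exists>p\<in>elems S. (\<exists>s. (\<forall>n::nat. s n \<in> D) \<and>
      (\<lambda>n. hnorm S (\<lambda>x. s n x - p x)) \<longlonglongrightarrow> 0) \<and> (\<forall>g\<in>D. ip S (\<lambda>x. f x - p x) g = 0)"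
proof -
  define \<delta> where "\<delta> = (INF g\<in>D. (hnorm S (\<lambda>x. f x - g x))\<^sup>2)"
  have bdd: "bdd_below ((\<lambda>g. (hnorm S (\<lambda>x. f x - g x))\<^sup>2) ` D)"
    by (rule bdd_belowI[of _ 0]) auto
  have \<delta>_le: "\<delta> \<le> (hnorm S (\<lambda>x. f x - g x))\<^sup>2" if "g \<in> D" for g
    unfolding \<delta>_def by (rule cINF_lower[OF bdd that])
  have "\<exists>g\<in>D. (hnorm S (\<lambda>x. f x - g x))\<^sup>2 < \<delta> + e" if "e > 0" for e
    using cINF_less_iff[of D "\<lambda>g. (hnorm S (\<lambda>x. f x - g x))\<^sup>2" "\<delta> + e"] D0 bdd that
    unfolding \<delta>_def by auto
  then have "\<exists>g\<in>D. (hnorm S (\<lambda>x. f x - g x))\<^sup>2 < \<delta> + 1 / real (Suc n)" for n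
    by simp
  then obtain s where sD: "\<And>n. s n \<in> D"
    and s: "\<And>n. (hnorm S (\<lambda>x. f x - s n x))\<^sup>2 < \<delta> + 1 / real (Suc n)"
    by metis
  have sS: "s n \<in> elems S" for n using sD D by blast
  have a: "(\<lambda>x. f x - s n x) \<in> elems S" for n using f sS diff_mem by blast
  have close: "(hnorm S (\<lambda>x. s p x - s q x))\<^sup>2 \<le> 2 / real (Suc p) + 2 / real (Suc q)" for p q
  proof -
    have plus: "(hnorm S (\<lambda>x. (f x - s p x) + 1 * (f x - s q x)))\<^sup>2
         = 4 * (hnorm S (\<lambda>x. f x - (s p x / 2 + s q x / 2)))\<^sup>2"
    proof -
      have mid: "(\<lambda>x. s p x / 2 + s q x / 2) \<in> elems S"
        using add_mem[OF scale_mem[OF sS[of p], of "1/2"] scale_mem[OF sS[of q], of "1/2"]] by simp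
      have "(\<lambda>x. (f x - s p x) + 1 * (f x - s q x)) = (\<lambda>x. 2 * (f x - (s p x / 2 + s q x / 2)))"
        by (auto simp: field_simps)
      then show ?thesis
        using hnorm_scale[OF diff_mem[OF f mid], of 2] by (simp add: power_mult_distrib)
    qed
    have mid: "(\<lambda>x. s p x / 2 + s q x / 2) \<in> D"
      using Dadd[OF Dadd[OF D0 sD[of p], of "1/2"] sD[of q], of "1/2"] by simp
    have minus: "(hnorm S (\<lambda>x. (f x - s p x) + (-1) * (f x - s q x)))\<^sup>2 =
        (hnorm S (\<lambda>x. s p x - s q x))\<^sup>2"
      using hnorm_diff_commute[OF sS[of p] sS[of q]] by simp
    have "4 * \<delta> + (hnorm S (\<lambda>x. s p x - s q x))\<^sup>2 \<le>
        2 * (hnorm S (\<lambda>x. f x - s p x))\<^sup>2 + 2 * (hnorm S (\<lambda>x. f x - s q x))\<^sup>2"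
      using \<delta>_le[OF mid] hnorm_expand[OF a[of p] a[of q], of 1]
        hnorm_expand[OF a[of p] a[of q], of "-1"] unfolding plus minus by simp
    then show ?thesis using s[of p] s[of q] by simp
  qed
  have cauchy: "\<exists>N. \<forall>p\<ge>N. \<forall>q\<ge>N. hnorm S (\<lambda>x. s p x - s q x) < e" if e: "e > 0" for e
  proof -
    obtain N where N: "1 / real (Suc N) < e\<^sup>2 / 4"
      using nat_approx_posE[of "e\<^sup>2 / 4"] e by (auto simp: )
    have "hnorm S (\<lambda>x. s p x - s q x) < e" if "p \<ge> N" "q \<ge> N" for p q
    proof -
      have "2 / real (Suc p) \<le> 2 / real (Suc N)" "2 / real (Suc q) \<le> 2 / real (Suc N)"
        using that by (auto intro!: divide_left_mono)
      then have "(hnorm S (\<lambda>x. s p x - s q x))\<^sup>2 \<le> 4 * (1 / real (Suc N))"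
        using close[of p q] by simp
      also have "\<dots> < e\<^sup>2" using N by simp
      finally show ?thesis using e by (simp add: power2_less_imp_less)
    qed
    then show ?thesis by blast
  qed
  obtain p where p: "p \<in> elems S" and lim: "(\<lambda>n. hnorm S (\<lambda>x. s n x - p x)) \<longlonglongrightarrow> 0"
    using complete[OF sS cauchy] by blast
  have "ip S (\<lambda>x. f x - p x) g = 0" if gD: "g \<in> D" for g
  proof -
    have g: "g \<in> elems S" using gD D by blast
    define N where "N = (hnorm S g)\<^sup>2"
    \<comment> \<open>Moving \<open>s n\<close> by a multiple of \<open>g\<close> cannot bring it closer to \<open>f\<close> than the infimum. A step
      proportional to the inner product, with \<open>t * N \<le> 1\<close> so that the quadratic term does not
      win, forces that inner product to be small.\<close>
    define t where "t = 1 / (N + 1)"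
    have N: "N \<ge> 0" by (simp add: N_def)
    have t: "t > 0" "t * N \<le> 1" using N by (auto simp: t_def field_simps)
    define b where "b n = ip S (\<lambda>x. f x - s n x) g" for n
    have b: "t * (cmod (b n))\<^sup>2 \<le> 1 / real (Suc n)" for n
    proof -
      define c where "c = - (of_real t * b n)"
      have "\<delta> \<le> (hnorm S (\<lambda>x. f x - (s n x + (-c) * g x)))\<^sup>2"
        by (rule \<delta>_le[OF Dadd[OF sD gD]])
      also have "(\<lambda>x. f x - (s n x + (-c) * g x)) = (\<lambda>x. (f x - s n x) + c * g x)"
        by auto
      also have "(hnorm S \<dots>)\<^sup>2 = (hnorm S (\<lambda>x. f x - s n x))\<^sup>2 + 2 * Re (cnj c * b n) + (cmod c)\<^sup>2 * N"
        unfolding b_def N_def by (rule hnorm_expand[OF a g])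
      also have "cnj c * b n = - of_real (t * (cmod (b n))\<^sup>2)"
        using complex_norm_square[of "b n"] by (simp add: c_def mult.commute mult.left_commute)
      also have "(cmod c)\<^sup>2 * N = (t * (cmod (b n))\<^sup>2) * (t * N)"
        by (simp add: c_def norm_mult power_mult_distrib power2_eq_square)
      finally have "2 * (t * (cmod (b n))\<^sup>2) \<le> 1 / real (Suc n) + (t * (cmod (b n))\<^sup>2) * (t * N)"
        using s[of n] by simp
      moreover have "(t * (cmod (b n))\<^sup>2) * (t * N) \<le> (t * (cmod (b n))\<^sup>2) * 1"
        using t by (intro mult_left_mono) auto
      ultimately show ?thesis by simp
    qed
    have "(\<lambda>n. inverse t * (1 / real (Suc n))) \<longlonglongrightarrow> inverse t * 0"
      by (intro tendsto_mult tendsto_const) (rule LIMSEQ_Suc[OF lim_1_over_n])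
    moreover have "(cmod (b n))\<^sup>2 \<le> inverse t * (1 / real (Suc n))" for n
      using mult_left_mono[OF b[of n], of "inverse t"] t by (simp add: mult.assoc[symmetric])
    ultimately have "(\<lambda>n. (cmod (b n))\<^sup>2) \<longlonglongrightarrow> 0"
      by (intro tendsto_sandwich[of "\<lambda>n. 0::real" "\<lambda>n. (cmod (b n))\<^sup>2" sequentially
            "\<lambda>n. inverse t * (1 / real (Suc n))" 0]) simp_all
    then have "(\<lambda>n. sqrt ((cmod (b n))\<^sup>2)) \<longlonglongrightarrow> sqrt 0"
      by (rule tendsto_real_sqrt)
    then have b0: "(\<lambda>n. cmod (b n)) \<longlonglongrightarrow> 0" by simp
    have "cmod (ip S (\<lambda>x. f x - p x) g) \<le> cmod (b n) + hnorm S (\<lambda>x. s n x - p x) * hnorm S g" for n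
    proof -
      have "ip S (\<lambda>x. f x - p x) g = b n + ip S (\<lambda>x. s n x - p x) g"
        unfolding b_def using f p sS g by (simp add: ip_diff_left)
      then show ?thesis
        using Cauchy_Schwarz[OF diff_mem[OF sS[of n] p] g] norm_triangle_ineq[of "b n"]
        by (smt (verit))
    qed
    moreover have "(\<lambda>n. cmod (b n) + hnorm S (\<lambda>x. s n x - p x) * hnorm S g) \<longlonglongrightarrow> 0 + 0 * hnorm S g"
      by (intro tendsto_intros b0 lim)
    ultimately have "cmod (ip S (\<lambda>x. f x - p x) g) \<le> 0 + 0 * hnorm S g"
      by (intro tendsto_lowerbound[where F=sequentially]) auto
    then show ?thesis by simp
  qed
  with p sD lim show ?thesis by blast
qed

end

inductive_set kernel_span :: "'x set \<Rightarrow> ('x \<Rightarrow> 'x \<Rightarrow> complex) \<Rightarrow> ('x \<Rightarrow> complex) set"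
  for X K where
  zero: "(\<lambda>x. 0) \<in> kernel_span X K"
| step: "f \<in> kernel_span X K \<Longrightarrow> w \<in> X \<Longrightarrow>
    (\<lambda>x. f x + c * (if x \<in> X then K x w else 0)) \<in> kernel_span X K"

lemma kernel_span_add_scale:
  assumes f: "f \<in> kernel_span X K" and g: "g \<in> kernel_span X K"
  shows "(\<lambda>x. f x + c * g x) \<in> kernel_span X K"
  using g
proof induction
  case zero
  show ?case using f by simp
next
  case (step g w b)
  have "(\<lambda>x. (f x + c * g x) + (c * b) * (if x \<in> X then K x w else 0)) \<in> kernel_span X K"
    by (rule kernel_span.step[OF step.IH step.hyps(2)])
  then show ?case by (simp add: algebra_simps)
qed

lemma tendsto_diff_zero_unique:
  fixes u :: "nat \<Rightarrow> complex"
  assumes "\<And>n. cmod (u n - a) \<le> A n * c" "A \<longlonglongrightarrow> 0"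
  shows "u \<longlonglongrightarrow> a"
proof -
  have "(\<lambda>n. A n * c) \<longlonglongrightarrow> 0" using tendsto_mult_left_zero[OF assms(2)] .
  then have "(\<lambda>n. u n - a) \<longlonglongrightarrow> 0"
    by (rule Lim_null_comparison[rotated]) (use assms(1) in auto)
  then show ?thesis by (simp add: LIM_zero_iff)
qed

locale rk_space = hfs X S for X :: "'x set" and S +
  fixes K :: "'x \<Rightarrow> 'x \<Rightarrow> complex"
  assumes rk: "has_reproducing_kernel X K S"
begin

abbreviation kern :: "'x \<Rightarrow> 'x \<Rightarrow> complex" where
  "kern w \<equiv> (\<lambda>x. if x \<in> X then K x w else 0)"

lemma kern_mem: "w \<in> X \<Longrightarrow> kern w \<in> elems S"
  and reproducing: "w \<in> X \<Longrightarrow> f \<in> elems S \<Longrightarrow> ip S f (kern w) = f w"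
  using rk unfolding has_reproducing_kernel_def by auto

lemma kernel_span_subset: "kernel_span X K \<subseteq> elems S"
proof
  fix f assume "f \<in> kernel_span X K"
  then show "f \<in> elems S"
    by induction (simp_all only: zero_mem add_mem scale_mem kern_mem)
qed

lemma eval_bound:
  assumes "w \<in> X" "f \<in> elems S" "g \<in> elems S"
  shows "cmod (f w - g w) \<le> hnorm S (\<lambda>x. f x - g x) * hnorm S (kern w)"
  using Cauchy_Schwarz[OF diff_mem[OF assms(2,3)] kern_mem[OF assms(1)]]
    reproducing[OF assms(1) diff_mem[OF assms(2,3)]] by simp

text \<open>
  A function orthogonal to all kernel functions vanishes at every point, so the projection to the
  closure of their span is the function itself.
\<close>

lemma kernel_span_dense:
  assumes f: "f \<in> elems S"
  shows "\<exists>s. (\<forall>n::nat. s n \<in> kernel_span X K) \<and> (\<lambda>n. hnorm S (\<lambda>x. s n x - f x)) \<longlonglongrightarrow> 0"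
proof -
  obtain p s where p: "p \<in> elems S" and s: "\<And>n::nat. s n \<in> kernel_span X K"
    "(\<lambda>n. hnorm S (\<lambda>x. s n x - p x)) \<longlonglongrightarrow> 0"
    and orth: "\<And>g. g \<in> kernel_span X K \<Longrightarrow> ip S (\<lambda>x. f x - p x) g = 0"
    using projection[OF kernel_span_subset kernel_span.zero kernel_span_add_scale f] by blast
  have "f x = p x" for x
  proof (cases "x \<in> X")
    case True
    have "kern x \<in> kernel_span X K"
      using kernel_span.step[OF kernel_span.zero True, where c = 1] by simp
    then show ?thesis
      using orth[of "kern x"] reproducing[OF True diff_mem[OF f p]] by simp
  next
    case False
    then show ?thesis using off_carrier[OF f] off_carrier[OF p] by simp
  qed
  then have "f = p" by blast
  then show ?thesis using s by blast
qed

end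

locale two_rk_spaces = A: rk_space X S K + B: rk_space X S' K
  for X :: "'x set" and S S' K
begin

text \<open>
  Against a kernel function the inner product is a point value, which no longer refers to the
  space.
\<close>

lemma ip_span_eq:
  assumes f: "f \<in> elems S" "f \<in> elems S'" and g: "g \<in> kernel_span X K"
  shows "ip S f g = ip S' f g"
  using g
proof induction
  case zero
  show ?case using f by (simp add: A.ip_zero_right B.ip_zero_right)
next
  case (step g w c)
  have "g \<in> elems S" "g \<in> elems S'"
    using step A.kernel_span_subset B.kernel_span_subset by blast+
  then show ?case
    using f step
    by (simp only: A.ip_add_right B.ip_add_right A.scale_mem B.scale_mem A.kern_mem B.kern_mem
        A.ip_scale_right B.ip_scale_right A.reproducing B.reproducing)
qed

text \<open>
  The two norms agree on the span of the kernel functions, so an approximating sequence for one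
  space is Cauchy in the other; pointwise evaluation identifies the two limits.
\<close>

lemma common_approximation:
  assumes f: "f \<in> elems S"
  shows "f \<in> elems S' \<and> (\<exists>s. (\<forall>n::nat. s n \<in> kernel_span X K) \<and>
    (\<lambda>n. hnorm S (\<lambda>x. s n x - f x)) \<longlonglongrightarrow> 0 \<and> (\<lambda>n. hnorm S' (\<lambda>x. s n x - f x)) \<longlonglongrightarrow> 0)"
proof -
  obtain s where s: "\<And>n::nat. s n \<in> kernel_span X K" "(\<lambda>n. hnorm S (\<lambda>x. s n x - f x)) \<longlonglongrightarrow> 0"
    using A.kernel_span_dense[OF f] by blast
  have sS: "s n \<in> elems S" "s n \<in> elems S'" for n
    using s(1) A.kernel_span_subset B.kernel_span_subset by blast+
  have hn: "hnorm S' (\<lambda>x. s p x - s q x) = hnorm S (\<lambda>x. s p x - s q x)" for p q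
  proof -
    have "(\<lambda>x. s p x + (-1) * s q x) \<in> kernel_span X K"
      by (rule kernel_span_add_scale[OF s(1) s(1)])
    then show ?thesis
      unfolding hnorm_def
      using ip_span_eq[of "\<lambda>x. s p x - s q x" "\<lambda>x. s p x - s q x"] A.diff_mem B.diff_mem sS by simp
  qed
  have "\<exists>N. \<forall>p\<ge>N. \<forall>q\<ge>N. hnorm S' (\<lambda>x. s p x - s q x) < e" if "e > 0" for e
  proof -
    have "\<forall>\<^sub>F n in sequentially. hnorm S (\<lambda>x. s n x - f x) < e / 2"
      using order_tendstoD(2)[OF s(2), of "e/2"] that by simp
    then obtain N where N: "\<And>n. n \<ge> N \<Longrightarrow> hnorm S (\<lambda>x. s n x - f x) < e / 2"
      unfolding eventually_sequentially by blast
    have "hnorm S' (\<lambda>x. s p x - s q x) < e" if "p \<ge> N" "q \<ge> N" for p q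
      using A.hnorm_triangle_diff[OF sS(1)[of p] f sS(1)[of q]] N[OF that(1)] N[OF that(2)]
        A.hnorm_diff_commute[OF f sS(1)[of q]] unfolding hn by linarith
    then show ?thesis by blast
  qed
  then obtain g where g: "g \<in> elems S'" "(\<lambda>n. hnorm S' (\<lambda>x. s n x - g x)) \<longlonglongrightarrow> 0"
    using B.complete[of s] sS by blast
  have "f x = g x" for x
  proof (cases "x \<in> X")
    case True
    have "(\<lambda>n. s n x) \<longlonglongrightarrow> f x"
      by (rule tendsto_diff_zero_unique[OF A.eval_bound[OF True sS(1) f] s(2)])
    moreover have "(\<lambda>n. s n x) \<longlonglongrightarrow> g x"
      by (rule tendsto_diff_zero_unique[OF B.eval_bound[OF True sS(2) g(1)] g(2)])
    ultimately show ?thesis by (rule LIMSEQ_unique)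
  next
    case False
    then show ?thesis using A.off_carrier[OF f] B.off_carrier[OF g(1)] by simp
  qed
  then have "f = g" by blast
  then show ?thesis using s g by blast
qed

lemma elems_subset: "elems S \<subseteq> elems S'"
  using common_approximation by blast

lemma ip_eq:
  assumes f: "f \<in> elems S" and g: "g \<in> elems S"
  shows "ip S f g = ip S' f g"
proof -
  obtain s where f': "f \<in> elems S'" and s: "\<And>n::nat. s n \<in> kernel_span X K"
    and lim: "(\<lambda>n. hnorm S (\<lambda>x. s n x - f x)) \<longlonglongrightarrow> 0" "(\<lambda>n. hnorm S' (\<lambda>x. s n x - f x)) \<longlonglongrightarrow> 0"
    using common_approximation[OF f] by blast
  have g': "g \<in> elems S'" using g elems_subset by blast
  have sS: "s n \<in> elems S" "s n \<in> elems S'" for n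
    using s A.kernel_span_subset B.kernel_span_subset by blast+
  have "(\<lambda>n. ip S (s n) g) \<longlonglongrightarrow> ip S f g"
    using A.Cauchy_Schwarz[OF A.diff_mem[OF sS(1) f] g] lim(1)
    by (intro tendsto_diff_zero_unique) (simp_all add: A.ip_diff_left[OF sS(1) f g])
  moreover have "(\<lambda>n. ip S' (s n) g) \<longlonglongrightarrow> ip S' f g"
    using B.Cauchy_Schwarz[OF B.diff_mem[OF sS(2) f'] g'] lim(2)
    by (intro tendsto_diff_zero_unique) (simp_all add: B.ip_diff_left[OF sS(2) f' g'])
  moreover have "ip S (s n) g = ip S' (s n) g" for n
    using ip_span_eq[OF g g' s] A.ip_sym[OF g sS(1)] B.ip_sym[OF g' sS(2)] by simp
  ultimately show ?thesis using LIMSEQ_unique by simp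
qed

end

theorem reproducing_kernel_unique:
  assumes "hilbert_fun_space X S" "has_reproducing_kernel X K S"
    and "hilbert_fun_space X S'" "has_reproducing_kernel X K S'"
  shows "S = S'"
proof -
  interpret AB: two_rk_spaces X S S' K
    by unfold_locales (use assms in auto)
  interpret BA: two_rk_spaces X S' S K
    by unfold_locales
  have el: "elems S = elems S'" using AB.elems_subset BA.elems_subset by blast
  have "ip S f g = ip S' f g" for f g
    using AB.ip_eq[of f g] AB.A.ip_off[of f g] AB.B.ip_off[of f g] el by metis
  then have "ip S = ip S'" by blast
  then show ?thesis using el by (cases S, cases S') simp
qed

section \<open>The Bergman-type spaces as weighted sequence spaces\<close>

definition coef :: "(complex \<Rightarrow> complex) \<Rightarrow> nat \<Rightarrow> complex" where
  "coef f n = (deriv ^^ n) f 0 / fact n"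

definition disc_fun :: "(complex \<Rightarrow> complex) \<Rightarrow> bool" where
  "disc_fun f \<longleftrightarrow> (\<forall>z. z \<notin> unit_disc \<longrightarrow> f z = 0) \<and> f holomorphic_on unit_disc"

lemma coef_sums:
  assumes "f holomorphic_on unit_disc" "z \<in> unit_disc"
  shows "(\<lambda>n. coef f n * z ^ n) sums f z"
  using holomorphic_power_series[of f 0 1 z] assms by (simp add: coef_def unit_disc_def)

lemma coef_eqI:
  assumes sums: "\<And>z. z \<in> unit_disc \<Longrightarrow> (\<lambda>n. a n * z ^ n) sums f z"
  shows "f holomorphic_on unit_disc" and "coef f n = a n"
proof -
  show "f holomorphic_on unit_disc"
    unfolding unit_disc_def
    by (rule power_series_holomorphic[of 0 1 a]) (use sums in \<open>simp add: unit_disc_def\<close>)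
  have "\<forall>\<^sub>F z in nhds 0. z \<in> unit_disc"
    unfolding unit_disc_def by (rule eventually_nhds_in_open) auto
  then have "f has_fps_expansion Abs_fps a"
    by (intro has_fps_expansionI) (auto elim!: eventually_mono dest: sums)
  from fps_nth_fps_expansion[OF this, of n] show "coef f n = a n"
    by (simp add: coef_def)
qed

lemma coef_add:
  assumes "f holomorphic_on unit_disc" "g holomorphic_on unit_disc"
  shows "coef (\<lambda>z. f z + g z) n = coef f n + coef g n"
  by (rule coef_eqI(2)) (use sums_add[OF coef_sums[OF assms(1)] coef_sums[OF assms(2)]] in
      \<open>simp add: algebra_simps\<close>)

lemma coef_scale:
  assumes "f holomorphic_on unit_disc"
  shows "coef (\<lambda>z. c * f z) n = c * coef f n"
  by (rule coef_eqI(2)) (use sums_mult[OF coef_sums[OF assms], of _ c] in \<open>simp add: algebra_simps\<close>)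

lemma coef_diff:
  assumes "f holomorphic_on unit_disc" "g holomorphic_on unit_disc"
  shows "coef (\<lambda>z. f z - g z) n = coef f n - coef g n"
  by (rule coef_eqI(2)) (use sums_diff[OF coef_sums[OF assms(1)] coef_sums[OF assms(2)]] in
      \<open>simp add: algebra_simps\<close>)

lemma coef_zero: "coef (\<lambda>z. 0) n = 0"
  by (rule coef_eqI(2)) simp

lemma coef_0: "coef f 0 = f 0"
  by (simp add: coef_def)

lemma disc_fun_eqI:
  assumes "disc_fun f" "disc_fun g" "\<And>n. coef f n = coef g n"
  shows "f = g"
proof
  fix z show "f z = g z"
    using coef_sums[of f z] coef_sums[of g z] assms sums_unique2
    by (cases "z \<in> unit_disc") (auto simp: disc_fun_def)
qed

lemma disc_fun_zero: "disc_fun (\<lambda>z. 0)"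
  and disc_fun_add: "disc_fun f \<Longrightarrow> disc_fun g \<Longrightarrow> disc_fun (\<lambda>z. f z + g z)"
  and disc_fun_scale: "disc_fun f \<Longrightarrow> disc_fun (\<lambda>z. c * f z)"
  by (auto simp: disc_fun_def intro!: holomorphic_intros)

text \<open>
  The weight \<open>wt a n\<close> is the squared norm of \<open>z ^ n\<close> in the space with kernel
  \<open>(1 - z * cnj w) powr (- 2 * a)\<close>; its reciprocal is the \<open>n\<close>-th coefficient of the binomial
  series of the kernel.
\<close>

definition wt :: "real \<Rightarrow> nat \<Rightarrow> real" where
  "wt a n = fact n / pochhammer (2 * a) n"

lemma wt_pos: "a > 0 \<Longrightarrow> 0 < wt a n"
  by (simp add: wt_def pochhammer_pos)

definition bspace :: "real \<Rightarrow> complex fun_space" where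
  "bspace a = (let H = {f. disc_fun f \<and> summable (\<lambda>n. wt a n * (cmod (coef f n))\<^sup>2)}
     in \<lparr>elems = H,
         ip = (\<lambda>f g. if f \<in> H \<and> g \<in> H
           then \<Sum>n. of_real (wt a n) * (coef f n * cnj (coef g n)) else 0)\<rparr>)"

lemma mem_bspace:
  "f \<in> elems (bspace a) \<longleftrightarrow> disc_fun f \<and> summable (\<lambda>n. wt a n * (cmod (coef f n))\<^sup>2)"
  by (simp add: bspace_def Let_def)

lemma ip_bspace:
  "ip (bspace a) f g = (if f \<in> elems (bspace a) \<and> g \<in> elems (bspace a)
     then \<Sum>n. of_real (wt a n) * (coef f n * cnj (coef g n)) else 0)"
  by (simp add: bspace_def Let_def)

lemma bspace_holomorphic: "f \<in> elems (bspace a) \<Longrightarrow> f holomorphic_on unit_disc"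
  by (simp add: mem_bspace disc_fun_def)

lemma kernel_sums:
  assumes "cmod x < 1"
  shows "(\<lambda>n. inverse (of_real (wt a n)) * x ^ n) sums ((1 - x) powr (- 2 * of_real a))"
proof -
  have "(\<lambda>n. ((- 2 * of_real a) gchoose n) * (- x) ^ n) sums (1 + - x) powr (- 2 * of_real a)"
    by (rule gen_binomial_complex) (use assms in simp)
  moreover have "((- 2 * of_real a) gchoose n) * (- x) ^ n = inverse (of_real (wt a n)) * x ^ n" for n
  proof -
    have "pochhammer (2 * complex_of_real a) n = of_real (pochhammer (2 * a) n)"
      by (simp flip: pochhammer_of_real)
    then show ?thesis
      by (simp add: gbinomial_pochhammer wt_def power_minus[of x] mult.assoc[symmetric])
  qed
  ultimately show ?thesis by simp
qed

lemma summable_inverse_wt: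
  assumes "0 \<le> r" "r < 1"
  shows "summable (\<lambda>n. inverse (wt a n) * r ^ n)"
proof -
  have "summable (\<lambda>n. inverse (of_real (wt a n)) * complex_of_real r ^ n)"
    using kernel_sums[of "complex_of_real r" a] assms by (auto simp: sums_iff)
  then have "summable (\<lambda>n. complex_of_real (inverse (wt a n) * r ^ n))"
    by simp
  then show ?thesis by (simp only: summable_complex_of_real)
qed

lemma real_mult_le_add_squares: "\<bar>x * y\<bar> \<le> x\<^sup>2 + (y::real)\<^sup>2"
proof -
  have "2 * (\<bar>x\<bar> * \<bar>y\<bar>) \<le> \<bar>x\<bar>\<^sup>2 + \<bar>y\<bar>\<^sup>2"
    using sum_squares_bound[of "\<bar>x\<bar>" "\<bar>y\<bar>"] by simp
  moreover have "0 \<le> \<bar>x\<bar> * \<bar>y\<bar>" by simp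
  ultimately show ?thesis by (simp only: abs_mult power2_abs)
qed

text \<open>
  The power series converges on the disc because \<open>\<bar>b n * z ^ n\<bar>\<close> is at most
  \<open>wt a n * \<bar>b n\<bar>\<^sup>2 + \<bar>z\<bar> ^ (2 * n) / wt a n\<close>, where the second terms sum to the kernel on the
  diagonal.
\<close>

lemma weighted_coef_function:
  assumes a: "a > 0" and b: "summable (\<lambda>n. wt a n * (cmod (b n))\<^sup>2)"
  shows "\<exists>f\<in>elems (bspace a). \<forall>n. coef f n = b n"
proof -
  define f where "f z = (if z \<in> unit_disc then \<Sum>n. b n * z ^ n else 0)" for z
  have sums: "(\<lambda>n. b n * z ^ n) sums f z" if z: "z \<in> unit_disc" for z
  proof -
    have "(cmod z)\<^sup>2 < 1" using z by (simp add: unit_disc_def abs_square_less_1)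
    then have "summable (\<lambda>n. wt a n * (cmod (b n))\<^sup>2 + inverse (wt a n) * ((cmod z)\<^sup>2) ^ n)"
      by (intro summable_add b summable_inverse_wt) auto
    moreover have "norm (b n * z ^ n) \<le> wt a n * (cmod (b n))\<^sup>2 + inverse (wt a n) * ((cmod z)\<^sup>2) ^ n" for n
    proof -
      define s where "s = sqrt (wt a n)"
      have s: "s > 0" "s\<^sup>2 = wt a n" using wt_pos[OF a, of n] by (auto simp: s_def)
      have "norm (b n * z ^ n) = \<bar>(s * cmod (b n)) * (inverse s * cmod z ^ n)\<bar>"
        using s by (simp add: norm_mult norm_power abs_mult)
      also have "\<dots> \<le> (s * cmod (b n))\<^sup>2 + (inverse s * cmod z ^ n)\<^sup>2"
        by (rule real_mult_le_add_squares)
      also have "\<dots> = wt a n * (cmod (b n))\<^sup>2 + inverse (wt a n) * ((cmod z)\<^sup>2) ^ n"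
        using s by (simp add: power_mult_distrib power_inverse power_mult[symmetric] mult.commute)
      finally show ?thesis .
    qed
    ultimately have "summable (\<lambda>n. b n * z ^ n)"
      by (rule summable_comparison_test'[where N = 0])
    then show ?thesis using z by (simp add: f_def summable_sums)
  qed
  have "f z = 0" if "z \<notin> unit_disc" for z using that by (simp add: f_def)
  then have "disc_fun f" using coef_eqI(1)[OF sums] by (simp add: disc_fun_def)
  moreover have "\<And>n. coef f n = b n" by (rule coef_eqI(2)[OF sums])
  ultimately show ?thesis using b by (intro bexI[of _ f]) (simp_all add: mem_bspace)
qed

lemma summable_weighted_add:
  assumes "summable (\<lambda>n. w n * (cmod (u n))\<^sup>2)" "summable (\<lambda>n. w n * (cmod (v n))\<^sup>2)"
    and w: "\<And>n. 0 \<le> w n"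
  shows "summable (\<lambda>n. w n * (cmod (u n + v n))\<^sup>2)"
proof (rule summable_comparison_test'[where N = 0])
  show "summable (\<lambda>n. 2 * (w n * (cmod (u n))\<^sup>2) + 2 * (w n * (cmod (v n))\<^sup>2))"
    by (intro summable_add summable_mult assms)
  fix n
  have "(cmod (u n + v n))\<^sup>2 \<le> (cmod (u n) + cmod (v n))\<^sup>2"
    by (intro power_mono norm_triangle_ineq) simp
  also have "\<dots> \<le> 2 * (cmod (u n))\<^sup>2 + 2 * (cmod (v n))\<^sup>2"
    using sum_squares_bound[of "cmod (u n)" "cmod (v n)"] by (simp add: power2_sum)
  finally have "w n * (cmod (u n + v n))\<^sup>2 \<le> w n * (2 * (cmod (u n))\<^sup>2 + 2 * (cmod (v n))\<^sup>2)"
    using w by (rule mult_left_mono)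
  then show "norm (w n * (cmod (u n + v n))\<^sup>2) \<le>
      2 * (w n * (cmod (u n))\<^sup>2) + 2 * (w n * (cmod (v n))\<^sup>2)"
    using w[of n] by (simp add: algebra_simps)
qed

lemma summable_weighted_mult:
  assumes "summable (\<lambda>n. w n * (cmod (u n))\<^sup>2)" "summable (\<lambda>n. w n * (cmod (v n))\<^sup>2)"
    and w: "\<And>n. 0 \<le> w n"
  shows "summable (\<lambda>n. of_real (w n) * (u n * cnj (v n)))"
proof (rule summable_comparison_test'[where N = 0])
  show "summable (\<lambda>n. w n * (cmod (u n))\<^sup>2 + w n * (cmod (v n))\<^sup>2)"
    by (intro summable_add assms)
  fix n
  show "norm (of_real (w n) * (u n * cnj (v n))) \<le> w n * (cmod (u n))\<^sup>2 + w n * (cmod (v n))\<^sup>2"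
    using mult_left_mono[OF real_mult_le_add_squares[of "cmod (u n)" "cmod (v n)"] w[of n]] w[of n]
    by (simp add: norm_mult abs_mult algebra_simps)
qed

context
  fixes a :: real
  assumes a: "a > 0"
begin

lemma bspace_zero: "(\<lambda>z. 0) \<in> elems (bspace a)"
  by (simp add: mem_bspace coef_zero disc_fun_zero)

lemma bspace_add:
  assumes f: "f \<in> elems (bspace a)" and g: "g \<in> elems (bspace a)"
  shows "(\<lambda>z. f z + g z) \<in> elems (bspace a)"
  using f g summable_weighted_add[of "wt a" "coef f" "coef g"] wt_pos[OF a]
  by (simp add: mem_bspace disc_fun_add coef_add[OF f[THEN bspace_holomorphic] g[THEN bspace_holomorphic]]
      less_imp_le)

lemma bspace_scale:
  assumes f: "f \<in> elems (bspace a)"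
  shows "(\<lambda>z. c * f z) \<in> elems (bspace a)"
  using f summable_mult[of "\<lambda>n. wt a n * (cmod (coef f n))\<^sup>2" "(cmod c)\<^sup>2"]
  by (simp add: mem_bspace disc_fun_scale coef_scale[OF f[THEN bspace_holomorphic]] norm_mult
      power_mult_distrib mult.left_commute)

lemma bspace_diff:
  assumes "f \<in> elems (bspace a)" "g \<in> elems (bspace a)"
  shows "(\<lambda>z. f z - g z) \<in> elems (bspace a)"
  using bspace_add[OF assms(1) bspace_scale[OF assms(2), of "-1"]] by simp

lemma bspace_ip_sums:
  assumes "f \<in> elems (bspace a)" "g \<in> elems (bspace a)"
  shows "(\<lambda>n. of_real (wt a n) * (coef f n * cnj (coef g n))) sums ip (bspace a) f g"
  using summable_weighted_mult[of "wt a" "coef f" "coef g"] assms wt_pos[OF a]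
  by (simp add: mem_bspace ip_bspace summable_sums less_imp_le)

lemma bspace_norm_sums:
  assumes f: "f \<in> elems (bspace a)"
  shows "(\<lambda>n. wt a n * (cmod (coef f n))\<^sup>2) sums (hnorm (bspace a) f)\<^sup>2"
    and "ip (bspace a) f f = of_real ((hnorm (bspace a) f)\<^sup>2)"
proof -
  have s: "(\<lambda>n. wt a n * (cmod (coef f n))\<^sup>2) sums (\<Sum>n. wt a n * (cmod (coef f n))\<^sup>2)"
    using f by (simp add: mem_bspace summable_sums)
  have "(\<lambda>n. of_real (wt a n) * (coef f n * cnj (coef f n))) sums
      of_real (\<Sum>n. wt a n * (cmod (coef f n))\<^sup>2)"
    using sums_of_real[OF s, where 'a = complex] by (simp add: complex_norm_square[symmetric])
  then have i: "ip (bspace a) f f = of_real (\<Sum>n. wt a n * (cmod (coef f n))\<^sup>2)"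
    using bspace_ip_sums[OF f f] sums_unique2 by blast
  have "0 \<le> (\<Sum>n. wt a n * (cmod (coef f n))\<^sup>2)"
    using f wt_pos[OF a] by (intro suminf_nonneg) (auto simp: mem_bspace less_imp_le)
  then have "(hnorm (bspace a) f)\<^sup>2 = (\<Sum>n. wt a n * (cmod (coef f n))\<^sup>2)"
    by (simp add: hnorm_def i)
  then show "(\<lambda>n. wt a n * (cmod (coef f n))\<^sup>2) sums (hnorm (bspace a) f)\<^sup>2"
    and "ip (bspace a) f f = of_real ((hnorm (bspace a) f)\<^sup>2)"
    using s i by simp_all
qed

lemma bspace_norm_ge_partial_sum:
  assumes f: "f \<in> elems (bspace a)" and "finite A"
  shows "(\<Sum>n\<in>A. wt a n * (cmod (coef f n))\<^sup>2) \<le> (hnorm (bspace a) f)\<^sup>2"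
  using sum_le_suminf[OF sums_summable[OF bspace_norm_sums(1)[OF f]], of A] assms(2) wt_pos[OF a]
    sums_unique[OF bspace_norm_sums(1)[OF f]] by (simp add: less_imp_le)

lemma bspace_coef_le:
  assumes f: "f \<in> elems (bspace a)"
  shows "wt a n * (cmod (coef f n))\<^sup>2 \<le> (hnorm (bspace a) f)\<^sup>2"
  using bspace_norm_ge_partial_sum[OF f, of "{n}"] by simp

lemma bspace_norm_leI:
  assumes f: "f \<in> elems (bspace a)"
    and le: "\<And>k. (\<Sum>n<k. wt a n * (cmod (coef f n))\<^sup>2) \<le> B"
  shows "(hnorm (bspace a) f)\<^sup>2 \<le> B"
  using suminf_le_const[OF sums_summable[OF bspace_norm_sums(1)[OF f]] le]
    sums_unique[OF bspace_norm_sums(1)[OF f]] by simp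

text \<open>
  Coefficients converge one by one, and the Cauchy estimate for finitely many of them passes to
  the limit.
\<close>

lemma bspace_complete:
  assumes s: "\<And>n. s n \<in> elems (bspace a)"
    and cauchy: "\<And>e. e > 0 \<Longrightarrow> \<exists>N. \<forall>p\<ge>N. \<forall>q\<ge>N. hnorm (bspace a) (\<lambda>z. s p z - s q z) < e"
  shows "\<exists>f\<in>elems (bspace a). (\<lambda>n. hnorm (bspace a) (\<lambda>z. s n z - f z)) \<longlonglongrightarrow> 0"
proof -
  have hol: "s p holomorphic_on unit_disc" for p by (rule bspace_holomorphic[OF s])
  have nn: "0 \<le> hnorm (bspace a) f" if "f \<in> elems (bspace a)" for f
  proof -
    have "0 \<le> Re (ip (bspace a) f f)"
      by (simp only: bspace_norm_sums(2)[OF that] Re_complex_of_real zero_le_power2)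
    then show ?thesis by (simp add: hnorm_def)
  qed
  have "Cauchy (\<lambda>p. coef (s p) n)" for n
  proof (rule CauchyI)
    fix e :: real assume e: "e > 0"
    define r where "r = sqrt (wt a n)"
    have r: "r > 0" "r\<^sup>2 = wt a n" using wt_pos[OF a, of n] by (auto simp: r_def)
    obtain N where N: "\<And>p q. p \<ge> N \<Longrightarrow> q \<ge> N \<Longrightarrow> hnorm (bspace a) (\<lambda>z. s p z - s q z) < r * e"
      using cauchy[of "r * e"] r e by auto
    have "cmod (coef (s p) n - coef (s q) n) < e" if "p \<ge> N" "q \<ge> N" for p q
    proof -
      have "(r * cmod (coef (s p) n - coef (s q) n))\<^sup>2 \<le> (hnorm (bspace a) (\<lambda>z. s p z - s q z))\<^sup>2"
        using bspace_coef_le[OF bspace_diff[OF s[of p] s[of q]], of n] r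
        by (simp add: power_mult_distrib coef_diff[OF hol hol])
      then have "r * cmod (coef (s p) n - coef (s q) n) \<le> hnorm (bspace a) (\<lambda>z. s p z - s q z)"
        by (rule power2_le_imp_le) (rule nn[OF bspace_diff[OF s s]])
      also have "\<dots> < r * e" by (rule N[OF that])
      finally show ?thesis using r by simp
    qed
    then show "\<exists>N. \<forall>p\<ge>N. \<forall>q\<ge>N. cmod (coef (s p) n - coef (s q) n) < e" by blast
  qed
  then have b: "(\<lambda>p. coef (s p) n) \<longlonglongrightarrow> lim (\<lambda>p. coef (s p) n)" for n
    by (simp add: Cauchy_convergent convergent_LIMSEQ_iff[symmetric])
  define b where "b n = lim (\<lambda>p. coef (s p) n)" for n
  note b = b[folded b_def]
  have tail: "(\<Sum>n<k. wt a n * (cmod (coef (s p) n - b n))\<^sup>2) \<le> e\<^sup>2"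
    if N: "\<And>p q. p \<ge> N \<Longrightarrow> q \<ge> N \<Longrightarrow> hnorm (bspace a) (\<lambda>z. s p z - s q z) < e" and p: "p \<ge> N"
    for N p e k
  proof (rule tendsto_upperbound)
    show "(\<lambda>q. \<Sum>n<k. wt a n * (cmod (coef (s p) n - coef (s q) n))\<^sup>2) \<longlonglongrightarrow>
        (\<Sum>n<k. wt a n * (cmod (coef (s p) n - b n))\<^sup>2)"
      by (intro tendsto_intros b)
    have "(\<Sum>n<k. wt a n * (cmod (coef (s p) n - coef (s q) n))\<^sup>2) \<le> e\<^sup>2" if "q \<ge> N" for q
    proof -
      have "(\<Sum>n<k. wt a n * (cmod (coef (s p) n - coef (s q) n))\<^sup>2) \<le>
          (hnorm (bspace a) (\<lambda>z. s p z - s q z))\<^sup>2"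
        using bspace_norm_ge_partial_sum[OF bspace_diff[OF s[of p] s[of q]], of "{..<k}"]
        by (simp add: coef_diff[OF hol hol])
      also have "\<dots> \<le> e\<^sup>2"
        using N[OF p that] nn[OF bspace_diff[OF s s]] by (intro power_mono) auto
      finally show ?thesis .
    qed
    then show "\<forall>\<^sub>F q in sequentially.
        (\<Sum>n<k. wt a n * (cmod (coef (s p) n - coef (s q) n))\<^sup>2) \<le> e\<^sup>2"
      unfolding eventually_sequentially by blast
  qed simp
  obtain N where "\<And>p q. p \<ge> N \<Longrightarrow> q \<ge> N \<Longrightarrow> hnorm (bspace a) (\<lambda>z. s p z - s q z) < 1"
    using cauchy[of 1] by auto
  from tail[OF this order_refl] have "summable (\<lambda>n. wt a n * (cmod (coef (s N) n - b n))\<^sup>2)"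
    using wt_pos[OF a] by (intro summableI_nonneg_bounded) (auto simp: less_imp_le)
  then have "summable (\<lambda>n. wt a n * (cmod (b n - coef (s N) n))\<^sup>2)"
    by (simp add: norm_minus_commute)
  then have "summable (\<lambda>n. wt a n * (cmod (b n))\<^sup>2)"
    using summable_weighted_add[of "wt a" "\<lambda>n. b n - coef (s N) n" "coef (s N)"] s[of N] wt_pos[OF a]
    by (simp add: mem_bspace less_imp_le)
  then obtain f where f: "f \<in> elems (bspace a)" and fb: "\<And>n. coef f n = b n"
    using weighted_coef_function[OF a, of b] by blast
  have "(\<lambda>p. hnorm (bspace a) (\<lambda>z. s p z - f z)) \<longlonglongrightarrow> 0"
  proof (rule LIMSEQ_I)
    fix e :: real assume e: "e > 0"
    obtain N where N: "\<And>p q. p \<ge> N \<Longrightarrow> q \<ge> N \<Longrightarrow> hnorm (bspace a) (\<lambda>z. s p z - s q z) < e / 2"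
      using cauchy[of "e / 2"] e by auto
    have "norm (hnorm (bspace a) (\<lambda>z. s p z - f z) - 0) < e" if p: "p \<ge> N" for p
    proof -
      have "(hnorm (bspace a) (\<lambda>z. s p z - f z))\<^sup>2 \<le> (e / 2)\<^sup>2"
        by (rule bspace_norm_leI[OF bspace_diff[OF s f]])
          (use tail[OF N p] in \<open>simp add: coef_diff[OF hol bspace_holomorphic[OF f]] fb\<close>)
      then have "hnorm (bspace a) (\<lambda>z. s p z - f z) \<le> e / 2"
        by (rule power2_le_imp_le) (use e in simp)
      then show ?thesis using e nn[OF bspace_diff[OF s f]] by simp
    qed
    then show "\<exists>N. \<forall>p\<ge>N. norm (hnorm (bspace a) (\<lambda>z. s p z - f z) - 0) < e" by blast
  qed
  then show ?thesis using f by blast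
qed

lemma bspace_hilbert: "hilbert_fun_space unit_disc (bspace a)"
  unfolding hilbert_fun_space_def
proof (intro conjI ballI allI impI)
  fix f g h :: "complex \<Rightarrow> complex" and c :: complex
  assume f: "f \<in> elems (bspace a)"
  note hf = bspace_holomorphic[OF f]
  show "f z = 0" if "z \<notin> unit_disc" for z
    using f that by (simp add: mem_bspace disc_fun_def)
  show "(\<lambda>z. c * f z) \<in> elems (bspace a)" by (rule bspace_scale[OF f])
  have "ip (bspace a) f f = of_real ((hnorm (bspace a) f)\<^sup>2)"
    by (rule bspace_norm_sums(2)[OF f])
  then show "0 \<le> Re (ip (bspace a) f f)" by simp
  show "f = (\<lambda>z. 0)" if "ip (bspace a) f f = 0"
  proof (rule disc_fun_eqI[OF _ disc_fun_zero])
    show "disc_fun f" using f by (simp add: mem_bspace)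
    fix n
    have "wt a n * (cmod (coef f n))\<^sup>2 \<le> 0"
      using bspace_coef_le[OF f, of n] bspace_norm_sums(2)[OF f] that by simp
    then show "coef f n = coef (\<lambda>z. 0) n"
      using wt_pos[OF a, of n] by (simp add: coef_zero mult_le_0_iff)
  qed
  assume g: "g \<in> elems (bspace a)"
  note hg = bspace_holomorphic[OF g]
  show "(\<lambda>z. f z + g z) \<in> elems (bspace a)" by (rule bspace_add[OF f g])
  show "ip (bspace a) (\<lambda>z. c * f z) g = c * ip (bspace a) f g"
    using sums_mult[OF bspace_ip_sums[OF f g], of c] bspace_ip_sums[OF bspace_scale[OF f, of c] g]
    by (intro sums_unique2[of "\<lambda>n. c * (of_real (wt a n) * (coef f n * cnj (coef g n)))"])
      (simp_all add: coef_scale[OF hf] algebra_simps)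
  have "(\<lambda>n. cnj (of_real (wt a n) * (coef f n * cnj (coef g n)))) sums cnj (ip (bspace a) f g)"
    using bspace_ip_sums[OF f g] by (simp only: sums_cnj)
  then show "ip (bspace a) g f = cnj (ip (bspace a) f g)"
    using bspace_ip_sums[OF g f]
    by (intro sums_unique2[of "\<lambda>n. of_real (wt a n) * (coef g n * cnj (coef f n))"])
      (simp_all add: algebra_simps)
  assume h: "h \<in> elems (bspace a)"
  show "ip (bspace a) (\<lambda>z. f z + g z) h = ip (bspace a) f h + ip (bspace a) g h"
    using sums_add[OF bspace_ip_sums[OF f h] bspace_ip_sums[OF g h]]
      bspace_ip_sums[OF bspace_add[OF f g] h]
    by (intro sums_unique2[of "\<lambda>n. of_real (wt a n) * (coef f n * cnj (coef h n)) +
          of_real (wt a n) * (coef g n * cnj (coef h n))"])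
      (simp_all add: coef_add[OF hf hg] algebra_simps)
next
  show "ip (bspace a) f g = 0" if "f \<notin> elems (bspace a) \<or> g \<notin> elems (bspace a)" for f g
    using that by (auto simp: ip_bspace)
  show "(\<lambda>z. 0) \<in> elems (bspace a)" by (rule bspace_zero)
  fix s :: "nat \<Rightarrow> complex \<Rightarrow> complex"
  assume "(\<forall>n. s n \<in> elems (bspace a)) \<and>
    (\<forall>e>0. \<exists>N. \<forall>p\<ge>N. \<forall>q\<ge>N. hnorm (bspace a) (\<lambda>x. s p x - s q x) < e)"
  then show "\<exists>f\<in>elems (bspace a). (\<lambda>n. hnorm (bspace a) (\<lambda>x. s n x - f x)) \<longlonglongrightarrow> 0"
    by (intro bspace_complete) auto
qed

text \<open>
  The kernel function at \<open>w\<close> has coefficients \<open>cnj w ^ n / wt a n\<close>: the weights cancel in the inner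
  product and leave the Taylor series of \<open>f\<close> at \<open>w\<close>.
\<close>

lemma bspace_reproducing:
  "has_reproducing_kernel unit_disc (\<lambda>z w. (1 - z * cnj w) powr (- 2 * of_real a)) (bspace a)"
  unfolding has_reproducing_kernel_def
proof (intro ballI conjI)
  fix w assume w: "w \<in> unit_disc"
  define k where "k = (\<lambda>z. if z \<in> unit_disc then (1 - z * cnj w) powr (- 2 * of_real a) else 0)"
  have sums: "(\<lambda>n. inverse (of_real (wt a n)) * cnj w ^ n * z ^ n) sums k z" if z: "z \<in> unit_disc" for z
  proof -
    have "cmod (z * cnj w) < 1"
      using z w mult_strict_mono'[of "cmod z" 1 "cmod w" 1] by (simp add: unit_disc_def norm_mult)
    from kernel_sums[OF this, of a] show ?thesis
      using z by (simp add: k_def power_mult_distrib mult_ac)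
  qed
  have ck: "coef k n = inverse (of_real (wt a n)) * cnj w ^ n" for n
    by (rule coef_eqI(2)[OF sums])
  have "disc_fun k" using coef_eqI(1)[OF sums] by (simp add: disc_fun_def k_def)
  moreover have "summable (\<lambda>n. wt a n * (cmod (coef k n))\<^sup>2)"
  proof -
    have "summable (\<lambda>n. inverse (wt a n) * ((cmod w)\<^sup>2) ^ n)"
      using w by (intro summable_inverse_wt) (auto simp: unit_disc_def abs_square_less_1)
    moreover have "wt a n * (cmod (coef k n))\<^sup>2 = inverse (wt a n) * ((cmod w)\<^sup>2) ^ n" for n
      using wt_pos[OF a, of n]
      by (simp add: ck norm_mult norm_inverse norm_power power_mult_distrib power2_eq_square)
    ultimately show ?thesis by simp
  qed
  ultimately have k: "k \<in> elems (bspace a)" by (simp add: mem_bspace)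
  show "(\<lambda>z. if z \<in> unit_disc then (1 - z * cnj w) powr (- 2 * of_real a) else 0) \<in> elems (bspace a)"
    using k by (simp add: k_def)
  fix f assume f: "f \<in> elems (bspace a)"
  have eq: "of_real (wt a n) * (coef f n * cnj (coef k n)) = coef f n * w ^ n" for n
    using wt_pos[OF a, of n] by (simp add: ck)
  have "(\<lambda>n. coef f n * w ^ n) sums ip (bspace a) f k"
    using bspace_ip_sums[OF f k] unfolding eq .
  then have "f w = ip (bspace a) f k"
    using coef_sums[OF bspace_holomorphic[OF f] w] sums_unique2 by blast
  then show "f w = ip (bspace a) f
      (\<lambda>z. if z \<in> unit_disc then (1 - z * cnj w) powr (- 2 * of_real a) else 0)"
    by (simp add: k_def)
qed

theorem bergman_eq_bspace: "bergman a = bspace a"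
  unfolding bergman_def
proof (rule the_equality, intro conjI ballI bspace_hilbert bspace_reproducing)
  show "f holomorphic_on unit_disc" if "f \<in> elems (bspace a)" for f
    by (rule bspace_holomorphic[OF that])
  show "S = bspace a"
    if "hilbert_fun_space unit_disc S \<and> (\<forall>f\<in>elems S. f holomorphic_on unit_disc) \<and>
      has_reproducing_kernel unit_disc (\<lambda>z w. (1 - z * cnj w) powr (- 2 * of_real a)) S" for S
    using that by (intro reproducing_kernel_unique[OF _ _ bspace_hilbert bspace_reproducing]) auto
qed

end

section \<open>Differentiation and shifts on the weighted spaces\<close>

lemma bspace_memI:
  assumes b: "b > 0" and g: "disc_fun g"
    and le: "\<And>k. (\<Sum>n<k. wt b n * (cmod (coef g n))\<^sup>2) \<le> B"
  shows "g \<in> elems (bspace b)" and "(hnorm (bspace b) g)\<^sup>2 \<le> B"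
proof -
  have "summable (\<lambda>n. wt b n * (cmod (coef g n))\<^sup>2)"
    using wt_pos[OF b] by (intro summableI_nonneg_bounded[OF _ le]) (auto simp: less_imp_le)
  then show "g \<in> elems (bspace b)" using g by (simp add: mem_bspace)
  then show "(hnorm (bspace b) g)\<^sup>2 \<le> B" by (rule bspace_norm_leI[OF b _ le])
qed

lemma hnorm_bspace_nonneg: "a > 0 \<Longrightarrow> 0 \<le> hnorm (bspace a) f"
  using hfs.hnorm_nonneg[OF hfs.intro[OF bspace_hilbert]] .

lemma bspace_shift_bound:
  assumes a: "a > 0" and b: "b > 0" and f: "f \<in> elems (bspace a)" and g: "disc_fun g"
    and C: "C \<ge> 0"
    and le: "\<And>n. wt b n * (cmod (coef g n))\<^sup>2 \<le> C * (wt a (n + k) * (cmod (coef f (n + k)))\<^sup>2)"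
  shows "g \<in> elems (bspace b)" and "hnorm (bspace b) g \<le> sqrt C * hnorm (bspace a) f"
proof -
  have "(\<Sum>n<N. wt b n * (cmod (coef g n))\<^sup>2) \<le> C * (hnorm (bspace a) f)\<^sup>2" for N
  proof -
    have "(\<Sum>n<N. wt b n * (cmod (coef g n))\<^sup>2) \<le>
        (\<Sum>n<N. C * (wt a (n + k) * (cmod (coef f (n + k)))\<^sup>2))"
      by (intro sum_mono le)
    also have "\<dots> = C * (\<Sum>n\<in>(\<lambda>n. n + k) ` {..<N}. wt a n * (cmod (coef f n))\<^sup>2)"
      by (simp add: sum.reindex sum_distrib_left)
    also have "\<dots> \<le> C * (hnorm (bspace a) f)\<^sup>2"
      by (intro mult_left_mono bspace_norm_ge_partial_sum[OF a f] C) simp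
    finally show ?thesis .
  qed
  from bspace_memI[OF b g this] show "g \<in> elems (bspace b)"
    and *: "hnorm (bspace b) g \<le> sqrt C * hnorm (bspace a) f"
    using real_le_rsqrt[of "hnorm (bspace b) g" "C * (hnorm (bspace a) f)\<^sup>2"]
      hnorm_bspace_nonneg[OF a, of f] by (simp_all add: real_sqrt_mult)
qed

lemma pochhammer_mono:
  fixes x y :: real
  assumes "0 \<le> x" "x \<le> y"
  shows "pochhammer x k \<le> pochhammer y k"
  using assms by (auto simp: pochhammer_prod intro!: prod_mono)

definition disc_deriv :: "nat \<Rightarrow> (complex \<Rightarrow> complex) \<Rightarrow> complex \<Rightarrow> complex" where
  "disc_deriv k f = (\<lambda>z. if z \<in> unit_disc then (deriv ^^ k) f z else 0)"

lemma disc_fun_disc_deriv: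
  assumes "f holomorphic_on unit_disc"
  shows "disc_fun (disc_deriv k f)"
proof -
  have "(deriv ^^ k) f holomorphic_on unit_disc"
    by (rule holomorphic_higher_deriv[OF assms]) (simp add: unit_disc_def)
  then have "disc_deriv k f holomorphic_on unit_disc"
    by (rule holomorphic_transform) (simp add: disc_deriv_def)
  then show ?thesis by (simp add: disc_fun_def) (simp add: disc_deriv_def)
qed

lemma coef_disc_deriv: "coef (disc_deriv k f) n = fact (n + k) / fact n * coef f (n + k)"
proof -
  have "\<forall>\<^sub>F z in nhds 0. z \<in> unit_disc"
    unfolding unit_disc_def by (rule eventually_nhds_in_open) auto
  then have "(deriv ^^ n) (disc_deriv k f) 0 = (deriv ^^ n) ((deriv ^^ k) f) 0"
    by (intro higher_deriv_cong_ev) (auto elim!: eventually_mono simp: disc_deriv_def)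
  then show ?thesis by (simp add: coef_def funpow_add)
qed

text \<open>
  The factor \<open>(n + 1) \<cdots> (n + k)\<close> picked up by \<open>k\<close> derivatives is compensated by passing from
  the weight of index \<open>a\<close> to that of index \<open>a + k\<close>.
\<close>

lemma wt_deriv_bound:
  assumes a: "a > 0"
  shows "wt (a + real k) n * (fact (n + k) / fact n)\<^sup>2 \<le> pochhammer (2 * a) (2 * k) * wt a (n + k)"
proof -
  define P where "P = pochhammer (2 * a + 2 * real k) n"
  define Q where "Q = pochhammer (2 * a) (n + k)"
  define R where "R = pochhammer (2 * a + real (n + k)) k"
  define T where "T = pochhammer (2 * a) (2 * k)"
  have pos: "P > 0" "Q > 0" "R > 0" "T > 0"
    using a by (auto simp: P_def Q_def R_def T_def intro!: pochhammer_pos)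
  have "T * P = pochhammer (2 * a) (2 * k + n)"
    unfolding T_def P_def by (subst pochhammer_product') simp
  also have "2 * k + n = (n + k) + k" by simp
  also have "pochhammer (2 * a) \<dots> = Q * R"
    unfolding Q_def R_def by (subst pochhammer_product') simp
  finally have TP: "T * P = Q * R" .
  have fact_eq: "fact (n + k) = (fact n * pochhammer (1 + real n) k :: real)"
    by (simp add: pochhammer_fact pochhammer_product')
  have "pochhammer (1 + real n) k \<le> R"
  proof (cases k)
    case (Suc k')
    then show ?thesis unfolding R_def using a by (intro pochhammer_mono) auto
  qed (simp add: R_def)
  then have "fact (n + k) \<le> fact n * R"
    unfolding fact_eq by (intro mult_left_mono) auto
  then have "fact (n + k) * Q \<le> fact n * (R * Q)"
    using pos by (simp add: mult.assoc[symmetric] mult_right_mono)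
  then have le: "fact (n + k) * Q \<le> fact n * (T * P)"
    by (simp only: TP mult.commute[of R Q])
  have "wt (a + real k) n * (fact (n + k) / fact n)\<^sup>2 =
      fact (n + k) / (fact n * P * Q) * (fact (n + k) * Q)"
  proof -
    have "wt (a + real k) n = fact n / P" by (simp add: wt_def P_def distrib_left)
    then show ?thesis using pos by (simp add: power2_eq_square field_simps)
  qed
  also have "\<dots> \<le> fact (n + k) / (fact n * P * Q) * (fact n * (T * P))"
    using pos by (intro mult_left_mono le) auto
  also have "\<dots> = T * wt a (n + k)"
  proof -
    have "wt a (n + k) = fact (n + k) / Q" by (simp add: wt_def Q_def)
    then show ?thesis using pos by (simp add: field_simps)
  qed
  finally show ?thesis unfolding T_def .
qed

lemma disc_deriv_bounded:
  assumes a: "a > 0" and f: "f \<in> elems (bspace a)"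
  shows "disc_deriv k f \<in> elems (bspace (a + real k))"
    and "hnorm (bspace (a + real k)) (disc_deriv k f) \<le>
      sqrt (pochhammer (2 * a) (2 * k)) * hnorm (bspace a) f"
proof -
  have ak: "a + real k > 0" using a by simp
  have C: "pochhammer (2 * a) (2 * k) \<ge> 0" using a by (simp add: pochhammer_nonneg)
  have "wt (a + real k) n * (cmod (coef (disc_deriv k f) n))\<^sup>2 \<le>
      pochhammer (2 * a) (2 * k) * (wt a (n + k) * (cmod (coef f (n + k)))\<^sup>2)" for n
  proof -
    have "cmod (fact (n + k) / fact n) = fact (n + k) / fact n"
      by (simp add: norm_divide)
    then have "wt (a + real k) n * (cmod (coef (disc_deriv k f) n))\<^sup>2 =
        (wt (a + real k) n * (fact (n + k) / fact n)\<^sup>2) * (cmod (coef f (n + k)))\<^sup>2"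
      by (simp only: coef_disc_deriv norm_mult power_mult_distrib mult.assoc)
    also have "\<dots> \<le> (pochhammer (2 * a) (2 * k) * wt a (n + k)) * (cmod (coef f (n + k)))\<^sup>2"
      by (intro mult_right_mono wt_deriv_bound[OF a]) simp
    finally show ?thesis by (simp add: mult.assoc)
  qed
  from bspace_shift_bound[OF a ak f disc_fun_disc_deriv[OF bspace_holomorphic[OF f]] C this]
  show "disc_deriv k f \<in> elems (bspace (a + real k))"
    and "hnorm (bspace (a + real k)) (disc_deriv k f) \<le>
      sqrt (pochhammer (2 * a) (2 * k)) * hnorm (bspace a) f" .
qed

lemma wt_Suc: "a > 0 \<Longrightarrow> wt a (Suc n) = wt a n * (real (Suc n) / (2 * a + real n))"
  by (simp add: wt_def pochhammer_rec' field_simps)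

lemma coef_mult_z:
  assumes f: "f holomorphic_on unit_disc"
  shows "coef (\<lambda>z. z * f z) n = (case n of 0 \<Rightarrow> 0 | Suc k \<Rightarrow> coef f k)"
proof (rule coef_eqI(2))
  fix z assume z: "z \<in> unit_disc"
  have "(\<lambda>n. z * (coef f n * z ^ n)) sums (z * f z)"
    by (rule sums_mult[OF coef_sums[OF f z]])
  then have "(\<lambda>n. (case Suc n of 0 \<Rightarrow> 0 | Suc k \<Rightarrow> coef f k) * z ^ Suc n) sums (z * f z)"
    by (simp add: algebra_simps)
  then show "(\<lambda>n. (case n of 0 \<Rightarrow> 0 | Suc k \<Rightarrow> coef f k) * z ^ n) sums (z * f z)"
    using sums_Suc_iff[of "\<lambda>n. (case n of 0 \<Rightarrow> 0 | Suc k \<Rightarrow> coef f k) * z ^ n" "z * f z"] by simp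
qed

lemma disc_fun_mult_z: "disc_fun f \<Longrightarrow> disc_fun (\<lambda>z. z * f z)"
  by (auto simp: disc_fun_def intro!: holomorphic_intros)

text \<open>
  The shift and its left inverse are bounded because the ratios of consecutive weights stay between
  two positive constants.
\<close>

lemma mult_z_bounded:
  assumes a: "a > 0" and f: "f \<in> elems (bspace a)"
  shows "(\<lambda>z. z * f z) \<in> elems (bspace a)"
    and "hnorm (bspace a) (\<lambda>z. z * f z) \<le> sqrt (1 + 1 / (2 * a)) * hnorm (bspace a) f"
proof -
  have df: "disc_fun (\<lambda>z. z * f z)" using f by (simp add: mem_bspace disc_fun_mult_z)
  define C where "C = 1 + 1 / (2 * a)"
  have C: "C \<ge> 0" using a by (simp add: C_def)
  have w: "wt a (Suc n) \<le> C * wt a n" for n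
  proof -
    have "real (Suc n) / (2 * a + real n) \<le> C"
      using a by (simp add: C_def field_simps)
    from mult_left_mono[OF this less_imp_le[OF wt_pos[OF a, of n]]] show ?thesis
      by (simp add: wt_Suc[OF a] mult_ac)
  qed
  have "(\<Sum>n<k. wt a n * (cmod (coef (\<lambda>z. z * f z) n))\<^sup>2) \<le> C * (hnorm (bspace a) f)\<^sup>2" for k
  proof -
    have "(\<Sum>n<k. wt a n * (cmod (coef (\<lambda>z. z * f z) n))\<^sup>2) \<le>
        (\<Sum>n<Suc k. wt a n * (cmod (coef (\<lambda>z. z * f z) n))\<^sup>2)"
      using wt_pos[OF a, of k] by (simp add: less_imp_le)
    also have "\<dots> = (\<Sum>n<k. wt a (Suc n) * (cmod (coef f n))\<^sup>2)"
      unfolding sum.lessThan_Suc_shift by (simp add: coef_mult_z[OF bspace_holomorphic[OF f]])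
    also have "\<dots> \<le> (\<Sum>n<k. C * (wt a n * (cmod (coef f n))\<^sup>2))"
      unfolding mult.assoc[symmetric] by (intro sum_mono mult_right_mono w) simp
    also have "\<dots> \<le> C * (hnorm (bspace a) f)\<^sup>2"
      unfolding sum_distrib_left[symmetric]
      by (intro mult_left_mono bspace_norm_ge_partial_sum[OF a f] C) simp
    finally show ?thesis .
  qed
  from bspace_memI[OF a df this] show "(\<lambda>z. z * f z) \<in> elems (bspace a)"
    and "hnorm (bspace a) (\<lambda>z. z * f z) \<le> sqrt (1 + 1 / (2 * a)) * hnorm (bspace a) f"
    using real_le_rsqrt[of "hnorm (bspace a) (\<lambda>z. z * f z)" "C * (hnorm (bspace a) f)\<^sup>2"]
      hnorm_bspace_nonneg[OF a, of f] by (simp_all add: real_sqrt_mult C_def)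
qed

lemma backward_shift:
  assumes a: "a > 0" and f: "f \<in> elems (bspace a)"
  shows "\<exists>g\<in>elems (bspace a). \<forall>z\<in>unit_disc. f z = f 0 + z * g z"
proof -
  have w: "wt a n \<le> (2 * a + 1) * wt a (n + 1)" for n
  proof -
    have "1 \<le> (2 * a + 1) * (real (Suc n) / (2 * a + real n))"
      using a by (simp add: field_simps)
    from mult_left_mono[OF this less_imp_le[OF wt_pos[OF a, of n]]] show ?thesis
      by (simp add: wt_Suc[OF a] mult_ac)
  qed
  have "summable (\<lambda>n. wt a n * (cmod (coef f (n + 1)))\<^sup>2)"
  proof (rule summable_comparison_test'[where N = 0])
    have "summable (\<lambda>n. wt a (n + 1) * (cmod (coef f (n + 1)))\<^sup>2)"
      using f summable_ignore_initial_segment[of "\<lambda>n. wt a n * (cmod (coef f n))\<^sup>2" 1]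
      by (simp add: mem_bspace)
    then show "summable (\<lambda>n. (2 * a + 1) * (wt a (n + 1) * (cmod (coef f (n + 1)))\<^sup>2))"
      by (rule summable_mult)
    fix n
    show "norm (wt a n * (cmod (coef f (n + 1)))\<^sup>2) \<le>
        (2 * a + 1) * (wt a (n + 1) * (cmod (coef f (n + 1)))\<^sup>2)"
      using mult_right_mono[OF w[of n], of "(cmod (coef f (n + 1)))\<^sup>2"] wt_pos[OF a, of n]
      by (simp add: mult.assoc)
  qed
  then obtain g where g: "g \<in> elems (bspace a)" and gc: "\<And>n. coef g n = coef f (n + 1)"
    using weighted_coef_function[OF a, of "\<lambda>n. coef f (n + 1)"] by blast
  have "f z = f 0 + z * g z" if z: "z \<in> unit_disc" for z
  proof -
    have "(\<lambda>n. coef (\<lambda>z. z * g z) n * z ^ n) sums (z * g z)"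
      by (rule coef_sums[OF bspace_holomorphic[OF mult_z_bounded(1)[OF a g]] z])
    moreover have "coef (\<lambda>z. z * g z) n * z ^ n =
        (if n = 0 then 0 else coef f n * z ^ n)" for n
      using coef_mult_z[OF bspace_holomorphic[OF g], of n] by (cases n) (simp_all add: gc)
    ultimately have "(\<lambda>n. (if n = 0 then 0 else coef f n * z ^ n)) sums (z * g z)" by simp
    moreover have "(\<lambda>n. if n = 0 then f 0 else 0) sums f 0"
      using sums_single[of 0 "\<lambda>n. f 0"] by simp
    ultimately have "(\<lambda>n. (if n = 0 then f 0 else 0) + (if n = 0 then 0 else coef f n * z ^ n))
        sums (f 0 + z * g z)"
      by (intro sums_add)
    moreover have "(if n = 0 then f 0 else 0) + (if n = 0 then 0 else coef f n * z ^ n) =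
        coef f n * z ^ n" for n
      by (simp add: coef_0)
    ultimately have "(\<lambda>n. coef f n * z ^ n) sums (f 0 + z * g z)" by simp
    then show ?thesis using coef_sums[OF bspace_holomorphic[OF f] z] sums_unique2 by blast
  qed
  then show ?thesis using g by blast
qed

lemma coef_mult_power:
  assumes f: "f \<in> elems (bspace a)" and a: "a > 0"
  shows "(\<lambda>z. z ^ n * f z) \<in> elems (bspace a)" and "coef (\<lambda>z. z ^ n * f z) (n + k) = coef f k"
proof (induction n)
  case (Suc n)
  case 1
  show ?case using mult_z_bounded(1)[OF a Suc.IH(1)] by (simp add: mult.assoc)
  case 2
  show ?case using coef_mult_z[OF bspace_holomorphic[OF Suc.IH(1)], of "Suc (n + k)"] Suc.IH(2)
    by (simp add: mult.assoc)
qed (use f in simp_all)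

text \<open>The coefficient of index \<open>n\<close> alone gives this part of the norm.\<close>

lemma mult_power_norm_ge:
  assumes a: "a > 0" and f: "f \<in> elems (bspace a)"
  shows "wt a n * (cmod (f 0))\<^sup>2 \<le> (hnorm (bspace a) (\<lambda>z. z ^ n * f z))\<^sup>2"
  using bspace_coef_le[OF a coef_mult_power(1)[OF f a], of n n] coef_mult_power(2)[OF f a, of n 0]
  by (simp add: coef_0)

definition disc_mono :: "nat \<Rightarrow> complex \<Rightarrow> complex" where
  "disc_mono n = (\<lambda>z. if z \<in> unit_disc then z ^ n else 0)"

lemma disc_mono_norm:
  assumes a: "a > 0"
  shows "disc_mono n \<in> elems (bspace a)" and "(hnorm (bspace a) (disc_mono n))\<^sup>2 = wt a n"
proof -
  have sums: "(\<lambda>k. (if k = n then 1 else 0) * z ^ k) sums disc_mono n z" if "z \<in> unit_disc" for z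
  proof -
    have "(\<lambda>k. (if k = n then 1 else 0) * z ^ k) = (\<lambda>k. if k = n then z ^ k else 0)" by auto
    then show ?thesis using sums_single[of n "\<lambda>k. z ^ k"] that by (simp add: disc_mono_def)
  qed
  have c: "coef (disc_mono n) k = (if k = n then 1 else 0)" for k
    by (rule coef_eqI(2)[OF sums])
  have "disc_mono n z = 0" if "z \<notin> unit_disc" for z using that by (simp add: disc_mono_def)
  then have "disc_fun (disc_mono n)"
    using coef_eqI(1)[OF sums] by (simp add: disc_fun_def)
  moreover have s: "(\<lambda>k. wt a k * (cmod (coef (disc_mono n) k))\<^sup>2) sums wt a n"
  proof -
    have "(\<lambda>k. wt a k * (cmod (coef (disc_mono n) k))\<^sup>2) = (\<lambda>k. if k = n then wt a k else 0)"
      by (auto simp: c)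
    then show ?thesis using sums_single[of n "wt a"] by simp
  qed
  ultimately show m: "disc_mono n \<in> elems (bspace a)"
    by (simp add: mem_bspace sums_iff)
  show "(hnorm (bspace a) (disc_mono n))\<^sup>2 = wt a n"
    by (rule sums_unique2[OF bspace_norm_sums(1)[OF a m] s])
qed

text \<open>
  By the Gamma limit \<open>wt a n\<close> is of order \<open>n powr (1 - 2 * a)\<close>, so weights with different indices
  are not comparable.
\<close>

lemma wt_ratio_tendsto_0:
  assumes b: "0 < b" and ab: "b < a"
  shows "(\<lambda>n. wt a (Suc n) / wt b (Suc n)) \<longlonglongrightarrow> 0"
proof -
  have nn: "2 * a \<notin> \<int>\<^sub>\<le>\<^sub>0" "2 * b \<notin> \<int>\<^sub>\<le>\<^sub>0"
    using b ab by (auto elim!: nonpos_Ints_cases)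
  have "(\<lambda>n. Gamma_series (2 * a) n / Gamma_series (2 * b) n * real n powr (- (2 * a - 2 * b)))
      \<longlonglongrightarrow> Gamma (2 * a) / Gamma (2 * b) * 0"
    using ab nn
    by (intro tendsto_mult tendsto_divide Gamma_series_LIMSEQ
        tendsto_neg_powr filterlim_real_sequentially) (auto simp: Gamma_eq_zero_iff)
  moreover have "\<forall>\<^sub>F n in sequentially.
      Gamma_series (2 * a) n / Gamma_series (2 * b) n * real n powr (- (2 * a - 2 * b)) =
      wt a (Suc n) / wt b (Suc n)"
    using eventually_gt_at_top[of 0]
  proof eventually_elim
    case (elim n)
    have p: "pochhammer (2 * a) (Suc n) > 0" "pochhammer (2 * b) (Suc n) > 0"
      using b ab by (auto intro!: pochhammer_pos)
    define E where "E = exp ((2 * a - 2 * b) * ln (real n))"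
    define E' where "E' = exp (2 * b * ln (real n))"
    have e: "exp (2 * a * ln (real n)) = E' * E" and E': "E' > 0"
      by (simp_all add: E_def E'_def exp_add[symmetric] algebra_simps)
    have "real n powr (- (2 * a - 2 * b)) = inverse E"
      using elim by (simp only: powr_minus) (simp add: powr_def E_def)
    moreover have "Gamma_series (2 * a) n / Gamma_series (2 * b) n =
        E * (pochhammer (2 * b) (Suc n) / pochhammer (2 * a) (Suc n))"
      using p E' by (simp add: Gamma_series_def e E'_def[symmetric])
    moreover have "E \<noteq> 0" by (simp add: E_def)
    ultimately show ?case using p by (simp add: wt_def)
  qed
  ultimately show ?thesis by (simp add: tendsto_cong)
qed

section \<open>The orthogonal sums and the triangular operator\<close>

definition coord :: "vec_fun \<Rightarrow> nat \<Rightarrow> nat \<Rightarrow> complex \<Rightarrow> complex" where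
  "coord F j i = (\<lambda>z. F (z, j, i))"

definition indices :: "nat \<Rightarrow> (nat \<Rightarrow> nat) \<Rightarrow> (nat \<times> nat) set" where
  "indices m d = (SIGMA j:{..m}. {..<d j})"

lemma finite_indices [simp]: "finite (indices m d)"
  by (simp add: indices_def)

lemma mem_indices: "(j, i) \<in> indices m d \<longleftrightarrow> j \<le> m \<and> i < d j"
  by (simp add: indices_def)

text \<open>
  Similarity of operators only depends on the norms up to equivalence. This allows
  \<open>H_I \<eta> m d Y\<close> to be replaced by the orthogonal sum, in which \<open>Y\<close> has disappeared.
\<close>

definition norm_equiv :: "'x fun_space \<Rightarrow> 'x fun_space \<Rightarrow> bool" where
  "norm_equiv S T \<longleftrightarrow> elems S = elems T \<and>
     (\<exists>c>0. \<forall>f\<in>elems S. 0 \<le> hnorm S f \<and> 0 \<le> hnorm T f \<and>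
        hnorm S f \<le> c * hnorm T f \<and> hnorm T f \<le> c * hnorm S f)"

lemma norm_equiv_sym: "norm_equiv S T \<Longrightarrow> norm_equiv T S"
  unfolding norm_equiv_def by metis

lemma bounded_linear_map_norm_equiv:
  assumes S: "norm_equiv S T" and S': "norm_equiv S' T'" and L: "bounded_linear_map S S' L"
  shows "bounded_linear_map T T' L"
proof -
  obtain c where e: "elems S = elems T" and c: "c > 0"
    and cS: "\<And>f. f \<in> elems S \<Longrightarrow> 0 \<le> hnorm S f \<and> hnorm S f \<le> c * hnorm T f"
    using S unfolding norm_equiv_def by metis
  obtain c' where e': "elems S' = elems T'" and c': "c' > 0"
    and cS': "\<And>f. f \<in> elems S' \<Longrightarrow> hnorm T' f \<le> c' * hnorm S' f"
    using S' unfolding norm_equiv_def by metis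
  obtain C where C: "\<And>f. f \<in> elems S \<Longrightarrow> hnorm S' (L f) \<le> C * hnorm S f"
    using L unfolding bounded_linear_map_def by metis
  have Lm: "\<And>f. f \<in> elems S \<Longrightarrow> L f \<in> elems S'"
    using L unfolding bounded_linear_map_def by metis
  have "hnorm T' (L f) \<le> (c' * (\<bar>C\<bar> * c)) * hnorm T f" if f: "f \<in> elems S" for f
  proof -
    have "hnorm T' (L f) \<le> c' * hnorm S' (L f)" by (rule cS'[OF Lm[OF f]])
    also have "\<dots> \<le> c' * (\<bar>C\<bar> * hnorm S f)"
    proof (rule mult_left_mono)
      have "C * hnorm S f \<le> \<bar>C\<bar> * hnorm S f"
        using cS[OF f] by (intro mult_right_mono) auto
      with C[OF f] show "hnorm S' (L f) \<le> \<bar>C\<bar> * hnorm S f" by simp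
    qed (use c' in simp)
    also have "\<dots> \<le> c' * (\<bar>C\<bar> * (c * hnorm T f))"
      using cS[OF f] c' by (intro mult_left_mono) auto
    finally show ?thesis by (simp add: mult.assoc)
  qed
  then have "\<exists>C. \<forall>f\<in>elems T. hnorm T' (L f) \<le> C * hnorm T f"
    unfolding e by blast
  then show ?thesis
    using L[unfolded bounded_linear_map_def e e'] unfolding bounded_linear_map_def
    by (elim conjE) (intro conjI, assumption+)
qed

lemma similar_ops_norm_equiv:
  assumes S: "norm_equiv S T" and S': "norm_equiv S' T'" and sim: "similar_ops S M S' M'"
  shows "similar_ops T M T' M'"
proof -
  have e: "elems S = elems T" "elems S' = elems T'"
    using S S' by (simp_all add: norm_equiv_def)
  obtain L L' where L: "bounded_linear_map S S' L" "bounded_linear_map S' S L'"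
    and inv: "\<forall>f\<in>elems S. L' (L f) = f" "\<forall>g\<in>elems S'. L (L' g) = g" "\<forall>f\<in>elems S. L (M f) = M' (L f)"
    and M: "bounded_linear_map S S M" "bounded_linear_map S' S' M'"
    using sim unfolding similar_ops_def by blast
  show ?thesis
    unfolding similar_ops_def
    using bounded_linear_map_norm_equiv[OF S S' L(1)] bounded_linear_map_norm_equiv[OF S' S L(2)]
      bounded_linear_map_norm_equiv[OF S S M(1)] bounded_linear_map_norm_equiv[OF S' S' M(2)]
      inv[unfolded e] by blast
qed

context
  fixes \<eta> :: real and m :: nat and d :: "nat \<Rightarrow> nat"
  assumes \<eta>: "\<eta> > 0"
begin

abbreviation "A \<equiv> sum_bergman \<eta> m d"

abbreviation "B j \<equiv> bspace (\<eta> + real j)"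

lemma weight_pos: "\<eta> + real j > 0"
  using \<eta> by simp

lemma B_hfs: "hfs unit_disc (B j)"
  by (rule hfs.intro[OF bspace_hilbert[OF weight_pos]])

lemma mem_A:
  "F \<in> elems A \<longleftrightarrow> (\<forall>z j i. (j, i) \<notin> indices m d \<longrightarrow> F (z, j, i) = 0) \<and>
     (\<forall>(j, i)\<in>indices m d. coord F j i \<in> elems (B j))"
  by (auto simp: sum_bergman_def Let_def bergman_eq_bspace[OF weight_pos] coord_def mem_indices)

lemma A_memI:
  assumes "\<And>z j i. (j, i) \<notin> indices m d \<Longrightarrow> F (z, j, i) = 0"
    and "\<And>j i. (j, i) \<in> indices m d \<Longrightarrow> coord F j i \<in> elems (B j)"
  shows "F \<in> elems A"
  using assms unfolding mem_A by blast

lemma A_off_index: "F \<in> elems A \<Longrightarrow> (j, i) \<notin> indices m d \<Longrightarrow> F (z, j, i) = 0"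
  unfolding mem_A by blast

lemma coord_mem: "F \<in> elems A \<Longrightarrow> (j, i) \<in> indices m d \<Longrightarrow> coord F j i \<in> elems (B j)"
  by (auto simp: mem_A)

lemma A_off_disc:
  assumes "F \<in> elems A" "z \<notin> unit_disc"
  shows "F (z, j, i) = 0"
proof (cases "(j, i) \<in> indices m d")
  case True
  have "coord F j i z = 0"
    by (rule hfs.off_carrier[OF B_hfs coord_mem[OF assms(1) True] assms(2)])
  then show ?thesis by (simp add: coord_def)
next
  case False
  then show ?thesis using assms by (simp add: A_off_index)
qed

lemma hnorm_A:
  assumes F: "F \<in> elems A"
  shows "(hnorm A F)\<^sup>2 = (\<Sum>(j, i)\<in>indices m d. (hnorm (B j) (coord F j i))\<^sup>2)"
    and "0 \<le> hnorm A F"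
proof -
  have m: "F \<in> elems A \<Longrightarrow> ip A F F = (\<Sum>j\<le>m. \<Sum>i<d j. ip (bergman (\<eta> + real j)) (coord F j i) (coord F j i))"
    unfolding sum_bergman_def Let_def coord_def by simp
  have "ip A F F = (\<Sum>(j, i)\<in>indices m d. ip (B j) (coord F j i) (coord F j i))"
    using m[OF F] by (simp add: bergman_eq_bspace[OF weight_pos] indices_def sum.Sigma)
  also have "\<dots> = (\<Sum>(j, i)\<in>indices m d. of_real ((hnorm (B j) (coord F j i))\<^sup>2))"
    by (rule sum.cong) (auto simp: bspace_norm_sums(2)[OF weight_pos coord_mem[OF F]])
  also have "\<dots> = of_real (\<Sum>(j, i)\<in>indices m d. (hnorm (B j) (coord F j i))\<^sup>2)"
    by (simp add: case_prod_unfold)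
  finally have i: "ip A F F = \<dots>" .
  have "0 \<le> (\<Sum>(j, i)\<in>indices m d. (hnorm (B j) (coord F j i))\<^sup>2)"
    by (intro sum_nonneg) auto
  then show "(hnorm A F)\<^sup>2 = (\<Sum>(j, i)\<in>indices m d. (hnorm (B j) (coord F j i))\<^sup>2)"
    and "0 \<le> hnorm A F"
    unfolding hnorm_def[of A] i by simp_all
qed

lemma hnorm_coord_le:
  assumes F: "F \<in> elems A" and p: "(j, i) \<in> indices m d"
  shows "hnorm (B j) (coord F j i) \<le> hnorm A F"
proof (rule power2_le_imp_le)
  have "(\<lambda>(j, i). (hnorm (B j) (coord F j i))\<^sup>2) (j, i) \<le>
      (\<Sum>(j, i)\<in>indices m d. (hnorm (B j) (coord F j i))\<^sup>2)"
    by (rule member_le_sum[OF p]) auto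
  then show "(hnorm (B j) (coord F j i))\<^sup>2 \<le> (hnorm A F)\<^sup>2"
    by (simp add: hnorm_A[OF F])
qed (rule hnorm_A(2)[OF F])

text \<open>
  Bounds for the finitely many coordinates combine into a bound for the whole. The comparison
  quantity \<open>R\<close> is left open so that upper and lower estimates for \<open>\<Gamma>\<close> are both instances.
\<close>

lemma hnorm_A_bound:
  assumes "\<And>p. p \<in> indices m d \<Longrightarrow>
    \<exists>C. \<forall>F\<in>elems A. hnorm (B (fst p)) (coord (T F) (fst p) (snd p)) \<le> C * R F"
    and T: "\<And>F. F \<in> elems A \<Longrightarrow> T F \<in> elems A"
    and R: "\<And>F. F \<in> elems A \<Longrightarrow> 0 \<le> R F"
  shows "\<exists>C. \<forall>F\<in>elems A. hnorm A (T F) \<le> C * R F"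
proof -
  obtain C where C: "\<And>p F. p \<in> indices m d \<Longrightarrow> F \<in> elems A \<Longrightarrow>
      hnorm (B (fst p)) (coord (T F) (fst p) (snd p)) \<le> C p * R F"
    using assms(1) by metis
  have "hnorm A (T F) \<le> sqrt (\<Sum>p\<in>indices m d. (C p)\<^sup>2) * R F" if F: "F \<in> elems A" for F
  proof -
    have "(hnorm A (T F))\<^sup>2 \<le> (\<Sum>p\<in>indices m d. (C p * R F)\<^sup>2)"
      unfolding hnorm_A(1)[OF T[OF F]] case_prod_unfold
      using hnorm_bspace_nonneg[OF weight_pos] C[OF _ F]
      by (intro sum_mono power_mono)
    also have "\<dots> = (\<Sum>p\<in>indices m d. (C p)\<^sup>2) * (R F)\<^sup>2"
      by (simp add: power_mult_distrib sum_distrib_right)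
    finally have "hnorm A (T F) \<le> sqrt ((\<Sum>p\<in>indices m d. (C p)\<^sup>2) * (R F)\<^sup>2)"
      by (rule real_le_rsqrt)
    then show ?thesis using R[OF F] by (simp add: real_sqrt_mult)
  qed
  then show ?thesis by blast
qed

lemma A_add: 
  assumes F: "F \<in> elems A" and G: "G \<in> elems A"
  shows "(\<lambda>x. F x + G x) \<in> elems A"
proof (rule A_memI)
  show "coord (\<lambda>x. F x + G x) j i \<in> elems (B j)" if p: "(j, i) \<in> indices m d" for j i
    using bspace_add[OF weight_pos coord_mem[OF F p] coord_mem[OF G p]] by (simp add: coord_def)
qed (simp add: F G A_off_index)

lemma A_scale: 
  assumes F: "F \<in> elems A"
  shows "(\<lambda>x. c * F x) \<in> elems A"
proof (rule A_memI)
  show "coord (\<lambda>x. c * F x) j i \<in> elems (B j)" if p: "(j, i) \<in> indices m d" for j i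
    using bspace_scale[OF weight_pos coord_mem[OF F p], of c] by (simp add: coord_def)
qed (simp add: F A_off_index)

lemma A_sum:
  "finite P \<Longrightarrow> (\<And>p. p \<in> P \<Longrightarrow> F p \<in> elems A) \<Longrightarrow> (\<lambda>x. \<Sum>p\<in>P. F p x) \<in> elems A"
proof (induction P rule: finite_induct)
  case empty
  show ?case by (rule A_memI) (simp_all add: coord_def bspace_zero[OF weight_pos])
next
  case (insert p P)
  then show ?case using A_add[of "F p" "\<lambda>x. \<Sum>p\<in>P. F p x"] by simp
qed

lemma coord_mult_op: "coord (mult_op F) j i = (\<lambda>z. z * coord F j i z)"
  by (simp add: coord_def mult_op_def)

lemma mult_op_mem: "F \<in> elems A \<Longrightarrow> mult_op F \<in> elems A"
  by (rule A_memI)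
    (simp add: mult_op_def A_off_index,
      simp add: coord_mult_op mult_z_bounded(1)[OF weight_pos coord_mem])

lemma mult_op_bounded: "bounded_linear_map A A mult_op"
  unfolding bounded_linear_map_def
proof (intro conjI ballI allI)
  show "mult_op F \<in> elems A" if "F \<in> elems A" for F by (rule mult_op_mem[OF that])
  show "\<exists>C. \<forall>F\<in>elems A. hnorm A (mult_op F) \<le> C * hnorm A F"
  proof (rule hnorm_A_bound)
    fix p assume "p \<in> indices m d"
    then obtain j i where p: "p = (j, i)" "(j, i) \<in> indices m d" by (cases p) auto
    have "hnorm (B j) (coord (mult_op F) j i) \<le> sqrt (1 + 1 / (2 * (\<eta> + real j))) * hnorm A F"
      if F: "F \<in> elems A" for F
    proof -
      have "hnorm (B j) (coord (mult_op F) j i) \<le>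
          sqrt (1 + 1 / (2 * (\<eta> + real j))) * hnorm (B j) (coord F j i)"
        unfolding coord_mult_op by (rule mult_z_bounded(2)[OF weight_pos coord_mem[OF F p(2)]])
      also have "\<dots> \<le> sqrt (1 + 1 / (2 * (\<eta> + real j))) * hnorm A F"
        using \<eta> by (intro mult_left_mono hnorm_coord_le[OF F p(2)]) auto
      finally show ?thesis .
    qed
    then show "\<exists>C. \<forall>F\<in>elems A.
        hnorm (B (fst p)) (coord (mult_op F) (fst p) (snd p)) \<le> C * hnorm A F"
      using p by auto
  qed (auto simp: mult_op_mem hnorm_A(2))
qed (auto simp: mult_op_def algebra_simps)

context
  fixes Y :: "complex mat"
begin

abbreviation "\<Gamma> \<equiv> Gamma_map \<eta> m d Y"

definition gcoef :: "nat \<Rightarrow> nat \<Rightarrow> nat \<Rightarrow> nat \<Rightarrow> complex" where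
  "gcoef l r j s = 1 / fact (l - j) *
     (1 / pochhammer (complex_of_real (2 * \<eta> + 2 * real j)) (l - j)) *
     block_prod d Y j (l - j) $$ (r, s)"

text \<open>
  The contribution to block \<open>l\<close> of the blocks strictly before it; the block itself enters through
  an identity matrix and no derivative.
\<close>

definition lower_part :: "vec_fun \<Rightarrow> nat \<Rightarrow> nat \<Rightarrow> complex \<Rightarrow> complex" where
  "lower_part F l r = (\<lambda>z. \<Sum>p\<in>(SIGMA j:{..<l}. {..<d j}).
     gcoef l r (fst p) (snd p) * disc_deriv (l - fst p) (coord F (fst p) (snd p)) z)"

lemma coord_Gamma:
  assumes F: "F \<in> elems A" and p: "(l, r) \<in> indices m d"
  shows "coord (\<Gamma> F) l r = (\<lambda>z. coord F l r z + lower_part F l r z)"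
proof
  fix z
  have lr: "l \<le> m" "r < d l" using p by (auto simp: mem_indices)
  show "coord (\<Gamma> F) l r z = coord F l r z + lower_part F l r z"
  proof (cases "z \<in> unit_disc")
    case True
    define t where "t j = 1 / fact (l - j) *
         (1 / pochhammer (complex_of_real (2 * \<eta> + 2 * real j)) (l - j)) *
         (\<Sum>s<d j. block_prod d Y j (l - j) $$ (r, s) *
            (deriv ^^ (l - j)) (\<lambda>w. F (w, j, s)) z)" for j
    have "coord (\<Gamma> F) l r z = (\<Sum>j\<le>l. t j)"
      using True lr by (simp add: coord_def Gamma_map_def t_def)
    also have "\<dots> = t l + (\<Sum>j<l. t j)"
      by (simp flip: lessThan_Suc_atMost)
    also have "t l = (\<Sum>s<d l. 1\<^sub>m (d l) $$ (r, s) * F (z, l, s))"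
      by (simp add: t_def)
    also have "\<dots> = (\<Sum>s<d l. if s = r then F (z, l, s) else 0)"
      using lr by (intro sum.cong) auto
    also have "\<dots> = coord F l r z"
      using lr by (simp add: coord_def)
    also have "(\<Sum>j<l. t j) = (\<Sum>j<l. \<Sum>s<d j. gcoef l r j s * disc_deriv (l - j) (coord F j s) z)"
      using True by (simp add: t_def gcoef_def disc_deriv_def coord_def sum_distrib_left mult.assoc)
    also have "\<dots> = lower_part F l r z"
      by (simp add: lower_part_def sum.Sigma case_prod_unfold)
    finally show ?thesis .
  next
    case False
    then show ?thesis
      using A_off_disc[OF F False]
      by (simp add: coord_def Gamma_map_def lower_part_def disc_deriv_def)
  qed
qed

lemma lower_index: "(l, r) \<in> indices m d \<Longrightarrow> p \<in> (SIGMA j:{..<l}. {..<d j}) \<Longrightarrow>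
    p \<in> indices m d \<and> fst p < l"
  by (auto simp: indices_def)

text \<open>
  Block \<open>j\<close> is differentiated exactly \<open>l - j\<close> times, which takes the space of index \<open>\<eta> + j\<close> to that
  of index \<open>\<eta> + l\<close>.
\<close>

lemma lower_part_bounded:
  assumes F: "F \<in> elems A" and p: "(l, r) \<in> indices m d"
  shows "lower_part F l r \<in> elems (B l)"
    and "hnorm (B l) (lower_part F l r) \<le> (\<Sum>(j, s)\<in>(SIGMA j:{..<l}. {..<d j}).
      cmod (gcoef l r j s) * (sqrt (pochhammer (2 * (\<eta> + real j)) (2 * (l - j))) *
        hnorm (B j) (coord F j s)))"
proof -
  interpret hfs unit_disc "B l" by (rule B_hfs)
  let ?P = "SIGMA j:{..<l}. {..<d j}"
  have *: "disc_deriv (l - fst q) (coord F (fst q) (snd q)) \<in> elems (B l)"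
    "hnorm (B l) (disc_deriv (l - fst q) (coord F (fst q) (snd q))) \<le>
      sqrt (pochhammer (2 * (\<eta> + real (fst q))) (2 * (l - fst q))) *
        hnorm (B (fst q)) (coord F (fst q) (snd q))" if q: "q \<in> ?P" for q
  proof -
    have "fst q < l" "(fst q, snd q) \<in> indices m d" using lower_index[OF p q] by auto
    then show "disc_deriv (l - fst q) (coord F (fst q) (snd q)) \<in> elems (B l)"
      "hnorm (B l) (disc_deriv (l - fst q) (coord F (fst q) (snd q))) \<le>
        sqrt (pochhammer (2 * (\<eta> + real (fst q))) (2 * (l - fst q))) *
          hnorm (B (fst q)) (coord F (fst q) (snd q))"
      using disc_deriv_bounded[OF weight_pos coord_mem[OF F], of "fst q" "snd q" "l - fst q"]
      by (simp_all add: of_nat_diff)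
  qed
  have fin: "finite ?P" by simp
  have s: "(\<lambda>z. gcoef l r (fst q) (snd q) * disc_deriv (l - fst q) (coord F (fst q) (snd q)) z)
      \<in> elems (B l)" if "q \<in> ?P" for q
    by (rule scale_mem[OF *(1)[OF that]])
  show "lower_part F l r \<in> elems (B l)"
    unfolding lower_part_def by (rule conjunct1[OF sum_mem_hnorm_le[OF fin s]])
  have "hnorm (B l) (lower_part F l r) \<le> (\<Sum>q\<in>?P. hnorm (B l)
      (\<lambda>z. gcoef l r (fst q) (snd q) * disc_deriv (l - fst q) (coord F (fst q) (snd q)) z))"
    unfolding lower_part_def by (rule conjunct2[OF sum_mem_hnorm_le[OF fin s]])
  also have "\<dots> \<le> (\<Sum>(j, s)\<in>?P.
      cmod (gcoef l r j s) * (sqrt (pochhammer (2 * (\<eta> + real j)) (2 * (l - j))) *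
        hnorm (B j) (coord F j s)))"
    unfolding case_prod_unfold
  proof (rule sum_mono)
    fix q assume q: "q \<in> ?P"
    show "hnorm (B l) (\<lambda>z. gcoef l r (fst q) (snd q) *
          disc_deriv (l - fst q) (coord F (fst q) (snd q)) z) \<le>
        cmod (gcoef l r (fst q) (snd q)) *
          (sqrt (pochhammer (2 * (\<eta> + real (fst q))) (2 * (l - fst q))) *
        hnorm (B (fst q)) (coord F (fst q) (snd q)))"
      unfolding hnorm_scale[OF *(1)[OF q]] by (intro mult_left_mono *(2)[OF q]) simp
  qed
  finally show "hnorm (B l) (lower_part F l r) \<le> \<dots>" .
qed

lemma Gamma_mem:
  assumes F: "F \<in> elems A"
  shows "\<Gamma> F \<in> elems A"
proof -
  have "coord (\<Gamma> F) l r \<in> elems (B l)" if p: "(l, r) \<in> indices m d" for l r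
    unfolding coord_Gamma[OF F p]
    by (rule bspace_add[OF weight_pos coord_mem[OF F p] lower_part_bounded(1)[OF F p]])
  then show ?thesis by (rule A_memI[rotated]) (auto simp: Gamma_map_def mem_indices)
qed

lemma Gamma_bounded: "\<exists>C. \<forall>F\<in>elems A. hnorm A (\<Gamma> F) \<le> C * hnorm A F"
proof (rule hnorm_A_bound)
  fix p assume "p \<in> indices m d"
  then obtain l r where p: "p = (l, r)" "(l, r) \<in> indices m d" by (cases p) auto
  let ?P = "SIGMA j:{..<l}. {..<d j}"
  define c where "c q = cmod (gcoef l r (fst q) (snd q)) *
      sqrt (pochhammer (2 * (\<eta> + real (fst q))) (2 * (l - fst q)))" for q
  have c: "0 \<le> c q" for q
    using \<eta> by (auto simp: c_def intro!: mult_nonneg_nonneg pochhammer_nonneg)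
  have "hnorm (B l) (coord (\<Gamma> F) l r) \<le> (1 + (\<Sum>q\<in>?P. c q)) * hnorm A F"
    if F: "F \<in> elems A" for F
  proof -
    have "hnorm (B l) (coord (\<Gamma> F) l r) \<le> hnorm (B l) (coord F l r) + hnorm (B l) (lower_part F l r)"
      unfolding coord_Gamma[OF F p(2)]
      by (rule hfs.hnorm_triangle[OF B_hfs coord_mem[OF F p(2)] lower_part_bounded(1)[OF F p(2)]])
    also have "hnorm (B l) (coord F l r) \<le> hnorm A F" by (rule hnorm_coord_le[OF F p(2)])
    also have "hnorm (B l) (lower_part F l r) \<le>
        (\<Sum>q\<in>?P. c q * hnorm (B (fst q)) (coord F (fst q) (snd q)))"
      using lower_part_bounded(2)[OF F p(2)] by (simp add: c_def case_prod_unfold mult.assoc)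
    also have "\<dots> \<le> (\<Sum>q\<in>?P. c q * hnorm A F)"
    proof (intro sum_mono mult_left_mono c)
      fix q assume "q \<in> ?P"
      then have "(fst q, snd q) \<in> indices m d" using lower_index[OF p(2)] by simp
      then show "hnorm (B (fst q)) (coord F (fst q) (snd q)) \<le> hnorm A F"
        by (rule hnorm_coord_le[OF F])
    qed
    finally show ?thesis by (simp add: algebra_simps sum_distrib_left)
  qed
  then show "\<exists>C. \<forall>F\<in>elems A.
      hnorm (B (fst p)) (coord (\<Gamma> F) (fst p) (snd p)) \<le> C * hnorm A F"
    using p by auto
qed (auto simp: Gamma_mem hnorm_A(2))

text \<open>
  Forward substitution: \<open>F\<^sub>l\<close> is \<open>(\<Gamma> F)\<^sub>l\<close> minus bounded images of the \<open>F\<^sub>j\<close> with \<open>j < l\<close>.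
\<close>

lemma Gamma_bounded_below_coord:
  "(l, r) \<in> indices m d \<Longrightarrow> \<exists>C. \<forall>F\<in>elems A. hnorm (B l) (coord F l r) \<le> C * hnorm A (\<Gamma> F)"
proof (induction l arbitrary: r rule: less_induct)
  case (less l)
  let ?P = "SIGMA j:{..<l}. {..<d j}"
  have "\<exists>C. \<forall>F\<in>elems A. hnorm (B (fst q)) (coord F (fst q) (snd q)) \<le> C * hnorm A (\<Gamma> F)"
    if "q \<in> ?P" for q
    using less.IH[of "fst q" "snd q"] lower_index[OF less.prems that] by simp
  then obtain D where D: "\<And>q F. q \<in> ?P \<Longrightarrow> F \<in> elems A \<Longrightarrow>
      hnorm (B (fst q)) (coord F (fst q) (snd q)) \<le> D q * hnorm A (\<Gamma> F)"
    by metis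
  define c where "c q = cmod (gcoef l r (fst q) (snd q)) *
      sqrt (pochhammer (2 * (\<eta> + real (fst q))) (2 * (l - fst q)))" for q
  have c: "0 \<le> c q" for q
    using \<eta> by (auto simp: c_def intro!: mult_nonneg_nonneg pochhammer_nonneg)
  have "hnorm (B l) (coord F l r) \<le> (1 + (\<Sum>q\<in>?P. c q * D q)) * hnorm A (\<Gamma> F)"
    if F: "F \<in> elems A" for F
  proof -
    interpret hfs unit_disc "B l" by (rule B_hfs)
    note mem = lower_part_bounded(1)[OF F less.prems]
    have "coord F l r = (\<lambda>z. coord (\<Gamma> F) l r z + (-1) * lower_part F l r z)"
      by (simp add: coord_Gamma[OF F less.prems])
    then have "hnorm (B l) (coord F l r) \<le> hnorm (B l) (coord (\<Gamma> F) l r) + hnorm (B l) (lower_part F l r)"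
      using hnorm_triangle[OF coord_mem[OF Gamma_mem[OF F] less.prems] scale_mem[OF mem, of "-1"]]
        hnorm_scale[OF mem, of "-1"] by simp
    also have "hnorm (B l) (coord (\<Gamma> F) l r) \<le> hnorm A (\<Gamma> F)"
      by (rule hnorm_coord_le[OF Gamma_mem[OF F] less.prems])
    also have "hnorm (B l) (lower_part F l r) \<le>
        (\<Sum>q\<in>?P. c q * hnorm (B (fst q)) (coord F (fst q) (snd q)))"
      using lower_part_bounded(2)[OF F less.prems] by (simp add: c_def case_prod_unfold mult.assoc)
    also have "\<dots> \<le> (\<Sum>q\<in>?P. c q * (D q * hnorm A (\<Gamma> F)))"
      by (intro sum_mono mult_left_mono D[OF _ F] c)
    finally show ?thesis by (simp add: algebra_simps sum_distrib_left)
  qed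
  then show ?case by blast
qed

lemma Gamma_bounded_below: "\<exists>C. \<forall>F\<in>elems A. hnorm A F \<le> C * hnorm A (\<Gamma> F)"
proof (rule hnorm_A_bound)
  fix p assume "p \<in> indices m d"
  then show "\<exists>C. \<forall>F\<in>elems A.
      hnorm (B (fst p)) (coord F (fst p) (snd p)) \<le> C * hnorm A (\<Gamma> F)"
    using Gamma_bounded_below_coord[of "fst p" "snd p"] by auto
qed (auto simp: Gamma_mem hnorm_A(2))

text \<open>
  Solving for one block after another: changing block \<open>k\<close> does not affect the lower parts of the
  blocks up to \<open>k\<close>, so the defect there can be added to it.
\<close>

lemma Gamma_solve:
  assumes G: "G \<in> elems A"
  shows "\<exists>F\<in>elems A. \<forall>(l, r)\<in>indices m d. l < k \<longrightarrow> coord (\<Gamma> F) l r = coord G l r"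
proof (induction k)
  case 0
  then show ?case using G by auto
next
  case (Suc k)
  then obtain F where F: "F \<in> elems A"
    and FG: "\<And>l r. (l, r) \<in> indices m d \<Longrightarrow> l < k \<Longrightarrow> coord (\<Gamma> F) l r = coord G l r"
    by blast
  define F' :: vec_fun where
    "F' = (\<lambda>(z, j, i). if j = k then F (z, j, i) + (G (z, j, i) - \<Gamma> F (z, j, i)) else F (z, j, i))"
  have c': "coord F' j i = (if j = k then (\<lambda>z. coord F j i z + (coord G j i z - coord (\<Gamma> F) j i z))
      else coord F j i)" for j i
    by (auto simp: F'_def coord_def)
  have "coord F' j i \<in> elems (B j)" if p: "(j, i) \<in> indices m d" for j i
    unfolding c' using F G Gamma_mem[OF F] coord_mem[OF _ p]
    by (auto intro!: bspace_add bspace_diff weight_pos)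
  moreover have "F' (z, j, i) = 0" if "(j, i) \<notin> indices m d" for z j i
  proof -
    have "F (z, j, i) = 0" "G (z, j, i) = 0" "\<Gamma> F (z, j, i) = 0"
      using that F G Gamma_mem[OF F] by (simp_all add: A_off_index)
    then show ?thesis by (auto simp: F'_def)
  qed
  ultimately have F': "F' \<in> elems A" by (intro A_memI)
  have low: "lower_part F' l r = lower_part F l r" if "l \<le> k" for l r
    unfolding lower_part_def using that by (intro ext sum.cong) (auto simp: c')
  have "coord (\<Gamma> F') l r = coord G l r" if p: "(l, r) \<in> indices m d" and l: "l < Suc k" for l r
  proof (cases "l = k")
    case True
    then show ?thesis
      unfolding coord_Gamma[OF F' p] c' low[OF less_Suc_eq_le[THEN iffD1, OF l]]
      by (simp add: coord_Gamma[OF F p[unfolded True]])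
  next
    case False
    then have "coord (\<Gamma> F') l r = coord (\<Gamma> F) l r"
      unfolding coord_Gamma[OF F' p] coord_Gamma[OF F p] using low[of l r] l by (simp add: c')
    then show ?thesis using FG[OF p] False l by simp
  qed
  then show ?case using F' by blast
qed

lemma Gamma_image: "\<Gamma> ` elems A = elems A"
proof (rule antisym)
  show "\<Gamma> ` elems A \<subseteq> elems A" using Gamma_mem by blast
  show "elems A \<subseteq> \<Gamma> ` elems A"
  proof
    fix G assume G: "G \<in> elems A"
    obtain F where F: "F \<in> elems A"
      and FG: "\<And>l r. (l, r) \<in> indices m d \<Longrightarrow> l < Suc m \<Longrightarrow> coord (\<Gamma> F) l r = coord G l r"
      using Gamma_solve[OF G, of "Suc m"] by blast
    have "\<Gamma> F (z, l, r) = G (z, l, r)" for z l r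
    proof (cases "(l, r) \<in> indices m d")
      case True
      then have "l < Suc m" by (simp add: mem_indices)
      then have "coord (\<Gamma> F) l r z = coord G l r z" using FG[OF True] by simp
      then show ?thesis by (simp add: coord_def)
    next
      case False
      then show ?thesis using G Gamma_mem[OF F] by (simp add: A_off_index)
    qed
    then have "\<Gamma> F = G" by (intro ext) auto
    then show "G \<in> \<Gamma> ` elems A" using F by blast
  qed
qed

text \<open>
  \<open>\<Gamma>\<close> maps the orthogonal sum onto itself and is bounded above and below there, so the norm that it
  transports is equivalent to the original one.
\<close>

lemma H_I_norm_equiv: "norm_equiv (H_I \<eta> m d Y) A"
proof -
  have el: "elems (H_I \<eta> m d Y) = elems A"
    by (simp add: H_I_def Let_def Gamma_image)
  have nrm: "hnorm (H_I \<eta> m d Y) F = hnorm A (inv_into (elems A) \<Gamma> F)"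
    and pre: "inv_into (elems A) \<Gamma> F \<in> elems A" "\<Gamma> (inv_into (elems A) \<Gamma> F) = F"
    if F: "F \<in> elems A" for F
  proof -
    have F': "F \<in> \<Gamma> ` elems A" using F by (simp only: Gamma_image)
    then show "hnorm (H_I \<eta> m d Y) F = hnorm A (inv_into (elems A) \<Gamma> F)"
      by (simp add: hnorm_def H_I_def Let_def)
    show "inv_into (elems A) \<Gamma> F \<in> elems A" by (rule inv_into_into[OF F'])
    show "\<Gamma> (inv_into (elems A) \<Gamma> F) = F" by (rule f_inv_into_f[OF F'])
  qed
  obtain C where C: "\<And>F. F \<in> elems A \<Longrightarrow> hnorm A (\<Gamma> F) \<le> C * hnorm A F"
    using Gamma_bounded by blast
  obtain D where D: "\<And>F. F \<in> elems A \<Longrightarrow> hnorm A F \<le> D * hnorm A (\<Gamma> F)"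
    using Gamma_bounded_below by blast
  define c where "c = \<bar>C\<bar> + \<bar>D\<bar> + 1"
  have c: "c > 0" "C \<le> c" "D \<le> c" by (auto simp: c_def)
  have "0 \<le> hnorm (H_I \<eta> m d Y) F \<and> 0 \<le> hnorm A F \<and>
      hnorm (H_I \<eta> m d Y) F \<le> c * hnorm A F \<and> hnorm A F \<le> c * hnorm (H_I \<eta> m d Y) F"
    if F: "F \<in> elems A" for F
    unfolding nrm[OF F]
    using C[OF pre(1)[OF F]] D[OF pre(1)[OF F]] hnorm_A(2)[OF F] hnorm_A(2)[OF pre(1)[OF F]]
      mult_right_mono[OF c(2) hnorm_A(2)[OF pre(1)[OF F]]] mult_right_mono[OF c(3) hnorm_A(2)[OF F]]
    unfolding pre(2)[OF F] by linarith
  then show ?thesis unfolding norm_equiv_def el using c(1) by blast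
qed

end

end

section \<open>Intertwining maps and their value at the origin\<close>

definition mono_vec :: "nat \<Rightarrow> nat \<times> nat \<Rightarrow> vec_fun" where
  "mono_vec n p = (\<lambda>(z, j, i). if (j, i) = p then disc_mono n z else 0)"

lemma coord_mono_vec:
  "coord (mono_vec n p) j i = (if (j, i) = p then disc_mono n else (\<lambda>z. 0))"
  by (auto simp: coord_def mono_vec_def)

lemma mono_vec_mem:
  assumes \<eta>: "\<eta> > 0" and p: "p \<in> indices m d"
  shows "mono_vec n p \<in> elems (sum_bergman \<eta> m d)"
proof (rule A_memI[OF \<eta>])
  show "coord (mono_vec n p) j i \<in> elems (bspace (\<eta> + real j))" for j i
    using disc_mono_norm(1)[OF weight_pos[OF \<eta>]] bspace_zero[OF weight_pos[OF \<eta>]]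
    by (simp add: coord_mono_vec)
qed (use p in \<open>auto simp: mono_vec_def\<close>)

lemma hnorm_mono_vec:
  assumes \<eta>: "\<eta> > 0" and p: "p \<in> indices m d"
  shows "(hnorm (sum_bergman \<eta> m d) (mono_vec n p))\<^sup>2 = wt (\<eta> + real (fst p)) n"
proof -
  have z: "(hnorm (bspace a) (\<lambda>z. 0))\<^sup>2 = 0" if "a > 0" for a
    using hfs.hnorm_scale[OF hfs.intro[OF bspace_hilbert[OF that]] bspace_zero[OF that], of 0]
    by simp
  have "(hnorm (sum_bergman \<eta> m d) (mono_vec n p))\<^sup>2 =
      (\<Sum>q\<in>indices m d. if q = p then wt (\<eta> + real (fst q)) n else 0)"
    unfolding hnorm_A(1)[OF \<eta> mono_vec_mem[OF \<eta> p]]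
    by (intro sum.cong)
      (auto simp: coord_mono_vec disc_mono_norm(2)[OF weight_pos[OF \<eta>]] z[OF weight_pos[OF \<eta>]])
  then show ?thesis using p by simp
qed

lemma mult_op_mono_vec: "mult_op (mono_vec n p) = mono_vec (Suc n) p"
  by (auto simp: mult_op_def mono_vec_def disc_mono_def)

lemma mult_op_pow: "(mult_op ^^ n) F = (\<lambda>(z, j, i). z ^ n * F (z, j, i))"
  by (induction n) (auto simp: mult_op_def)

lemma bounded_linear_map_sum:
  assumes \<eta>: "\<eta> > 0" and L: "bounded_linear_map (sum_bergman \<eta> m d) S' L"
    and P: "finite P" and F: "\<And>p. p \<in> P \<Longrightarrow> F p \<in> elems (sum_bergman \<eta> m d)"
  shows "L (\<lambda>x. \<Sum>p\<in>P. c p * F p x) = (\<lambda>y. \<Sum>p\<in>P. c p * L (F p) y)"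
  using P F
proof (induction P rule: finite_induct)
  case empty
  have z: "(\<lambda>x. 0) \<in> elems (sum_bergman \<eta> m d)"
    using A_sum[OF \<eta>, of "{}" "\<lambda>p x. 0"] by simp
  have "L (\<lambda>x. c * f x) = (\<lambda>y. c * L f y)" if "f \<in> elems (sum_bergman \<eta> m d)" for c f
    using L that unfolding bounded_linear_map_def by blast
  from this[OF z, of 0] show ?case by simp
next
  case (insert p P)
  let ?G = "\<lambda>x. \<Sum>p\<in>P. c p * F p x"
  have G: "?G \<in> elems (sum_bergman \<eta> m d)"
    using insert by (intro A_sum[OF \<eta>] A_scale[OF \<eta>]) auto
  have Fp: "F p \<in> elems (sum_bergman \<eta> m d)" using insert by simp
  have "L (\<lambda>x. c p * F p x + ?G x) = (\<lambda>y. L (\<lambda>x. c p * F p x) y + L ?G y)"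
  proof -
    have "L (\<lambda>x. f x + g x) = (\<lambda>y. L f y + L g y)"
      if "f \<in> elems (sum_bergman \<eta> m d)" "g \<in> elems (sum_bergman \<eta> m d)" for f g
      using L that unfolding bounded_linear_map_def by blast
    from this[OF A_scale[OF \<eta> Fp] G] show ?thesis .
  qed
  moreover have "L (\<lambda>x. c p * F p x) = (\<lambda>y. c p * L (F p) y)"
    using L Fp unfolding bounded_linear_map_def by blast
  ultimately show ?case using insert by simp
qed

locale intertwiner =
  fixes \<eta> \<eta>' :: real and m m' :: nat and d d' :: "nat \<Rightarrow> nat" and L :: "vec_fun \<Rightarrow> vec_fun"
  assumes \<eta>: "\<eta> > 0" and \<eta>': "\<eta>' > 0"
    and L: "bounded_linear_map (sum_bergman \<eta> m d) (sum_bergman \<eta>' m' d') L"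
    and L_mult: "\<And>F. F \<in> elems (sum_bergman \<eta> m d) \<Longrightarrow> L (mult_op F) = mult_op (L F)"
begin

lemma L_mem: "F \<in> elems (sum_bergman \<eta> m d) \<Longrightarrow> L F \<in> elems (sum_bergman \<eta>' m' d')"
  using L by (simp add: bounded_linear_map_def)

lemma L_mono_vec:
  assumes p: "p \<in> indices m d"
  shows "L (mono_vec n p) = (mult_op ^^ n) (L (mono_vec 0 p))"
proof (induction n)
  case (Suc n)
  have "L (mono_vec (Suc n) p) = mult_op (L (mono_vec n p))"
    unfolding mult_op_mono_vec[symmetric] by (rule L_mult[OF mono_vec_mem[OF \<eta> p]])
  then show ?case using Suc by simp
qed simp

text \<open>
  The squared norm of \<open>mono_vec n p\<close> is \<open>wt (\<eta> + fst p) n\<close>. Its image is \<open>z ^ n\<close> times the image of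
  \<open>mono_vec 0 p\<close>, so the \<open>q\<close>-th value at the origin contributes its squared modulus times
  \<open>wt (\<eta>' + fst q) n\<close> to the squared norm there.
\<close>

lemma value_nonzero_imp_le:
  assumes p: "p \<in> indices m d" and q: "q \<in> indices m' d'"
    and nz: "L (mono_vec 0 p) (0, q) \<noteq> 0"
  shows "\<eta> + real (fst p) \<le> \<eta>' + real (fst q)"
proof (rule ccontr)
  define a where "a = \<eta> + real (fst p)"
  define b where "b = \<eta>' + real (fst q)"
  assume "\<not> ?thesis"
  then have ab: "b < a" by (simp add: a_def b_def)
  have a: "a > 0" and b: "b > 0" using \<eta> \<eta>' by (auto simp: a_def b_def)
  define x where "x = L (mono_vec 0 p) (0, q)"
  have q': "(fst q, snd q) \<in> indices m' d'" using q by simp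
  obtain C where C: "\<And>F. F \<in> elems (sum_bergman \<eta> m d) \<Longrightarrow>
      hnorm (sum_bergman \<eta>' m' d') (L F) \<le> C * hnorm (sum_bergman \<eta> m d) F"
    using L unfolding bounded_linear_map_def by blast
  have key: "(cmod x)\<^sup>2 \<le> C\<^sup>2 * (wt a n / wt b n)" for n
  proof -
    define G where "G = L (mono_vec n p)"
    have Gm: "G \<in> elems (sum_bergman \<eta>' m' d')"
      unfolding G_def by (rule L_mem[OF mono_vec_mem[OF \<eta> p]])
    define g where "g = coord (L (mono_vec 0 p)) (fst q) (snd q)"
    have g: "g \<in> elems (bspace b)"
      unfolding g_def b_def by (rule coord_mem[OF \<eta>' L_mem[OF mono_vec_mem[OF \<eta> p]] q'])
    have cG: "coord G (fst q) (snd q) = (\<lambda>z. z ^ n * g z)"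
      unfolding G_def L_mono_vec[OF p, of n] mult_op_pow g_def by (simp add: coord_def)
    have "wt b n * (cmod x)\<^sup>2 \<le> (hnorm (bspace b) (coord G (fst q) (snd q)))\<^sup>2"
      using mult_power_norm_ge[OF b g, of n] unfolding cG by (simp add: x_def g_def coord_def)
    also have "\<dots> \<le> (hnorm (sum_bergman \<eta>' m' d') G)\<^sup>2"
      using hnorm_coord_le[OF \<eta>' Gm q'] hnorm_bspace_nonneg[OF b]
      by (intro power_mono) (simp_all add: b_def)
    also have "\<dots> \<le> (C * hnorm (sum_bergman \<eta> m d) (mono_vec n p))\<^sup>2"
      unfolding G_def using C[OF mono_vec_mem[OF \<eta> p]] hnorm_A(2)[OF \<eta>' Gm]
      by (intro power_mono) (simp_all add: G_def)
    also have "\<dots> = C\<^sup>2 * wt a n"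
      by (simp add: power_mult_distrib hnorm_mono_vec[OF \<eta> p] a_def)
    finally show ?thesis using wt_pos[OF b, of n] by (simp add: field_simps)
  qed
  have "(\<lambda>n. C\<^sup>2 * (wt a (Suc n) / wt b (Suc n))) \<longlonglongrightarrow> C\<^sup>2 * 0"
    by (intro tendsto_mult tendsto_const wt_ratio_tendsto_0[OF b ab])
  then have "(cmod x)\<^sup>2 \<le> C\<^sup>2 * 0"
    by (rule tendsto_lowerbound) (use key in auto)
  then show False using nz by (simp add: x_def)
qed

text \<open>
  Up to a constant function, \<open>F\<close> is \<open>z\<close> times an element of the space, and the image of such a
  multiple is again divisible by \<open>z\<close>. So the value of \<open>L F\<close> at the origin depends linearly on the
  value of \<open>F\<close> there.
\<close>

lemma value_at_0:
  assumes F: "F \<in> elems (sum_bergman \<eta> m d)"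
  shows "L F (0, q) = (\<Sum>p\<in>indices m d. F (0, p) * L (mono_vec 0 p) (0, q))"
proof -
  have "\<exists>g\<in>elems (bspace (\<eta> + real (fst p))). \<forall>z\<in>unit_disc.
      coord F (fst p) (snd p) z = coord F (fst p) (snd p) 0 + z * g z" if "p \<in> indices m d" for p
    using that by (intro backward_shift[OF weight_pos[OF \<eta>] coord_mem[OF \<eta> F]]) simp
  then obtain g where g: "\<And>p. p \<in> indices m d \<Longrightarrow> g p \<in> elems (bspace (\<eta> + real (fst p)))"
    and Fg: "\<And>p z. p \<in> indices m d \<Longrightarrow> z \<in> unit_disc \<Longrightarrow>
      coord F (fst p) (snd p) z = coord F (fst p) (snd p) 0 + z * g p z"
    by metis
  define G :: vec_fun where "G = (\<lambda>(z, j, i). if (j, i) \<in> indices m d then g (j, i) z else 0)"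
  have G: "G \<in> elems (sum_bergman \<eta> m d)"
  proof (rule A_memI[OF \<eta>])
    show "coord G j i \<in> elems (bspace (\<eta> + real j))" if "(j, i) \<in> indices m d" for j i
      using g[OF that] that by (simp add: G_def coord_def)
  qed (simp add: G_def)
  define H where "H = (\<lambda>x. \<Sum>p\<in>indices m d. F (0, p) * mono_vec 0 p x)"
  have H: "H \<in> elems (sum_bergman \<eta> m d)"
    unfolding H_def by (intro A_sum[OF \<eta>] A_scale[OF \<eta>] mono_vec_mem[OF \<eta>]) auto
  have Hv: "H (z, p) = (if p \<in> indices m d \<and> z \<in> unit_disc then F (0, p) else 0)" for z p
  proof -
    have "H (z, p) = (\<Sum>q\<in>indices m d. if q = p then (if z \<in> unit_disc then F (0, q) else 0) else 0)"
      unfolding H_def by (intro sum.cong) (auto simp: mono_vec_def disc_mono_def split: prod.splits)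
    then show ?thesis by simp
  qed
  have "F (z, p) = H (z, p) + mult_op G (z, p)" for z p
  proof (cases "p \<in> indices m d")
    case True
    show ?thesis
    proof (cases "z \<in> unit_disc")
      case z: True
      show ?thesis using Fg[OF True z] True z by (cases p) (simp add: Hv coord_def mult_op_def G_def)
    next
      case False
      then show ?thesis
        using A_off_disc[OF \<eta> F False] A_off_disc[OF \<eta> G False]
        by (cases p) (simp add: Hv mult_op_def)
    qed
  next
    case False
    then show ?thesis
      using A_off_index[OF \<eta> F] by (cases p) (simp add: Hv mult_op_def G_def)
  qed
  then have "F = (\<lambda>x. H x + mult_op G x)" by auto
  then have "L F = L (\<lambda>x. H x + mult_op G x)" by simp
  also have "\<dots> = (\<lambda>y. L H y + L (mult_op G) y)"
    using L H mult_op_mem[OF \<eta> G] unfolding bounded_linear_map_def by blast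
  also have "L (mult_op G) = mult_op (L G)" by (rule L_mult[OF G])
  also have "L H = (\<lambda>y. \<Sum>p\<in>indices m d. F (0, p) * L (mono_vec 0 p) y)"
    unfolding H_def by (rule bounded_linear_map_sum[OF \<eta> L]) (auto intro: mono_vec_mem[OF \<eta>])
  finally show ?thesis by (cases q) (simp add: mult_op_def)
qed

end

text \<open>
  Both sides are the trace of the product of the two mutually inverse matrices restricted to the
  level \<open>t\<close>; the comparison of levels makes all other entries drop out.
\<close>

lemma card_levels_eq:
  fixes A B :: "'p \<Rightarrow> 'q \<Rightarrow> complex" and e :: "'p \<Rightarrow> real" and e' :: "'q \<Rightarrow> real"
  assumes fin: "finite J" "finite J'"
    and BA: "\<And>p. p \<in> J \<Longrightarrow> (\<Sum>q\<in>J'. A p q * B p q) = 1"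
    and AB: "\<And>q. q \<in> J' \<Longrightarrow> (\<Sum>p\<in>J. A p q * B p q) = 1"
    and A: "\<And>p q. p \<in> J \<Longrightarrow> q \<in> J' \<Longrightarrow> A p q \<noteq> 0 \<Longrightarrow> e p \<le> e' q"
    and B: "\<And>p q. p \<in> J \<Longrightarrow> q \<in> J' \<Longrightarrow> B p q \<noteq> 0 \<Longrightarrow> e' q \<le> e p"
  shows "card {p \<in> J. e p = t} = card {q \<in> J'. e' q = t}"
proof -
  have level: "e' q = e p" if "p \<in> J" "q \<in> J'" "A p q \<noteq> 0" "B p q \<noteq> 0" for p q
    using A[OF that(1-3)] B[OF that(1,2,4)] by simp
  let ?E = "{p \<in> J. e p = t}" and ?E' = "{q \<in> J'. e' q = t}"
  have "complex_of_nat (card ?E) = (\<Sum>p\<in>?E. \<Sum>q\<in>J'. A p q * B p q)"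
    using BA by simp
  also have "\<dots> = (\<Sum>p\<in>?E. \<Sum>q\<in>?E'. A p q * B p q)"
    by (rule sum.cong[OF refl], intro sum.mono_neutral_right) (use fin in \<open>auto dest: level\<close>)
  also have "\<dots> = (\<Sum>q\<in>?E'. \<Sum>p\<in>?E. A p q * B p q)" by (rule sum.swap)
  also have "\<dots> = (\<Sum>q\<in>?E'. \<Sum>p\<in>J. A p q * B p q)"
    by (rule sum.cong[OF refl], intro sum.mono_neutral_left) (use fin in \<open>auto dest: level\<close>)
  also have "\<dots> = complex_of_nat (card ?E')" using AB by simp
  finally show ?thesis by simp
qed

lemma similar_imp_level_cards_eq:
  assumes \<eta>: "\<eta> > 0" and \<eta>': "\<eta>' > 0"
    and sim: "similar_ops (sum_bergman \<eta> m d) mult_op (sum_bergman \<eta>' m' d') mult_op"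
  shows "card {p \<in> indices m d. \<eta> + real (fst p) = t} =
    card {q \<in> indices m' d'. \<eta>' + real (fst q) = t}"
proof -
  obtain L L' where L: "bounded_linear_map (sum_bergman \<eta> m d) (sum_bergman \<eta>' m' d') L"
      "bounded_linear_map (sum_bergman \<eta>' m' d') (sum_bergman \<eta> m d) L'"
    and L'L: "\<And>F. F \<in> elems (sum_bergman \<eta> m d) \<Longrightarrow> L' (L F) = F"
    and LL': "\<And>G. G \<in> elems (sum_bergman \<eta>' m' d') \<Longrightarrow> L (L' G) = G"
    and LM: "\<And>F. F \<in> elems (sum_bergman \<eta> m d) \<Longrightarrow> L (mult_op F) = mult_op (L F)"
    using sim unfolding similar_ops_def by blast
  interpret I: intertwiner \<eta> \<eta>' m m' d d' L
    by unfold_locales (use \<eta> \<eta>' L(1) LM in auto)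
  have L'm: "\<And>G. G \<in> elems (sum_bergman \<eta>' m' d') \<Longrightarrow> L' G \<in> elems (sum_bergman \<eta> m d)"
    using L(2) by (simp add: bounded_linear_map_def)
  have "L' (mult_op G) = mult_op (L' G)" if G: "G \<in> elems (sum_bergman \<eta>' m' d')" for G
  proof -
    have "L' (mult_op G) = L' (L (mult_op (L' G)))"
      using LM[OF L'm[OF G]] LL'[OF G] by simp
    also have "\<dots> = mult_op (L' G)" by (rule L'L[OF mult_op_mem[OF \<eta> L'm[OF G]]])
    finally show ?thesis .
  qed
  then interpret I': intertwiner \<eta>' \<eta> m' m d' d L'
    by unfold_locales (use \<eta> \<eta>' L(2) in auto)
  define P where "P p q = L (mono_vec 0 p) (0, q)" for p q
  define Q where "Q p q = L' (mono_vec 0 q) (0, p)" for p q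
  have diag: "mono_vec 0 p (0, p) = 1" for p
    by (cases p) (simp add: mono_vec_def disc_mono_def unit_disc_def)
  show ?thesis
  proof (rule card_levels_eq[where A = P and B = Q])
    show "(\<Sum>q\<in>indices m' d'. P p q * Q p q) = 1" if p: "p \<in> indices m d" for p
      using I'.value_at_0[OF I.L_mem[OF mono_vec_mem[OF \<eta> p, of 0]], of p]
        L'L[OF mono_vec_mem[OF \<eta> p, of 0]] by (simp add: P_def Q_def diag)
    show "(\<Sum>p\<in>indices m d. P p q * Q p q) = 1" if q: "q \<in> indices m' d'" for q
      using I.value_at_0[OF I'.L_mem[OF mono_vec_mem[OF \<eta>' q, of 0]], of q]
        LL'[OF mono_vec_mem[OF \<eta>' q, of 0]] by (simp add: P_def Q_def diag mult.commute)
    show "\<eta> + real (fst p) \<le> \<eta>' + real (fst q)"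
      if "p \<in> indices m d" "q \<in> indices m' d'" "P p q \<noteq> 0" for p q
      using I.value_nonzero_imp_le[OF that(1,2)] that(3) by (simp add: P_def)
    show "\<eta>' + real (fst q) \<le> \<eta> + real (fst p)"
      if "p \<in> indices m d" "q \<in> indices m' d'" "Q p q \<noteq> 0" for p q
      using I'.value_nonzero_imp_le[OF that(2,1)] that(3) by (simp add: Q_def)
  qed simp_all
qed

lemma card_level:
  "card {p \<in> indices m d. \<eta> + real (fst p) = \<eta> + real j} = (if j \<le> m then d j else 0)"
proof -
  have "{p \<in> indices m d. \<eta> + real (fst p) = \<eta> + real j} = (if j \<le> m then {j} \<times> {..<d j} else {})"
    by (auto simp: indices_def)
  then show ?thesis by simp
qed

text \<open>The level \<open>\<eta>\<close> is occupied by block 0, and all levels of the other side are at least \<open>\<eta>'\<close>.\<close>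

lemma level_cards_eq_imp_le:
  assumes "d 0 \<ge> 1"
    and eq: "\<And>t. card {p \<in> indices m d. \<eta> + real (fst p) = t} =
      card {q \<in> indices m' d'. \<eta>' + real (fst q) = t}"
  shows "\<eta>' \<le> \<eta>"
proof -
  have "card {q \<in> indices m' d'. \<eta>' + real (fst q) = \<eta>} \<noteq> 0"
    using eq[of \<eta>] card_level[of m d \<eta> 0] assms(1) by simp
  then have "{q \<in> indices m' d'. \<eta>' + real (fst q) = \<eta>} \<noteq> {}" by force
  then show ?thesis by auto
qed

lemma level_cards_determine:
  assumes d: "\<forall>j\<le>m. d j \<ge> 1" and d': "\<forall>j\<le>m'. d' j \<ge> 1"
    and eq: "\<And>t. card {p \<in> indices m d. \<eta> + real (fst p) = t} =
      card {q \<in> indices m' d'. \<eta>' + real (fst q) = t}"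
  shows "(m = m' \<and> (\<forall>j\<le>m. d j = d' j)) \<and> \<eta> = \<eta>'"
proof -
  have \<eta>: "\<eta> = \<eta>'"
    using level_cards_eq_imp_le[of d m \<eta> m' d' \<eta>', OF _ eq]
      level_cards_eq_imp_le[of d' m' \<eta>' m d \<eta>, OF _ eq[symmetric]] d d' by simp
  have c: "(if j \<le> m then d j else 0) = (if j \<le> m' then d' j else 0)" for j
    using eq[of "\<eta> + real j"] unfolding \<eta> card_level .
  have "m \<le> m'" using c[of m] d by (auto split: if_splits)
  moreover have "m' \<le> m" using c[of m'] d' by (auto split: if_splits)
  ultimately show ?thesis using c \<eta> by (metis le_antisym)
qed

lemma sum_bergman_cong:
  assumes "\<forall>j\<le>m. d j = d' j"
  shows "sum_bergman \<eta> m d = sum_bergman \<eta> m d'"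
proof -
  have [simp]: "j \<le> m \<and> i < d j \<longleftrightarrow> j \<le> m \<and> i < d' j" for j i using assms by auto
  have sums: "(\<Sum>j\<le>m. \<Sum>i<d j. f j i) = (\<Sum>j\<le>m. \<Sum>i<d' j. f j i)" for f :: "nat \<Rightarrow> nat \<Rightarrow> complex"
    using assms by (intro sum.cong) auto
  then show ?thesis
    unfolding sum_bergman_def Let_def sums using assms by (simp cong: conj_cong)
qed

lemma similar_mult_op_refl:
  assumes \<eta>: "\<eta> > 0"
  shows "similar_ops (sum_bergman \<eta> m d) mult_op (sum_bergman \<eta> m d) mult_op"
proof -
  have "bounded_linear_map (sum_bergman \<eta> m d) (sum_bergman \<eta> m d) (\<lambda>F. F)"
    unfolding bounded_linear_map_def by (auto intro!: exI[of _ 1])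
  then show ?thesis
    unfolding similar_ops_def using mult_op_bounded[OF \<eta>, of m d]
    by (intro conjI exI[of _ "\<lambda>F. F"]) auto
qed

theorem theorem4p2:
  fixes \<eta> \<eta>' :: real and m m' :: nat and d d' :: "nat \<Rightarrow> nat" and Y Y' :: "complex mat"
  assumes "\<eta> > 0" and "\<eta>' > 0"
    and "\<forall>j\<le>m. d j \<ge> 1" and "\<forall>j\<le>m'. d' j \<ge> 1"
    and "block_subdiagonal m d Y" and "block_subdiagonal m' d' Y'"
  shows "similar_ops (H_I \<eta> m d Y) mult_op (H_I \<eta>' m' d' Y') mult_op \<longleftrightarrow>
         (m = m' \<and> (\<forall>j\<le>m. d j = d' j)) \<and> \<eta> = \<eta>'"
proof -
  note equiv = H_I_norm_equiv[OF assms(1), of m d Y] H_I_norm_equiv[OF assms(2), of m' d' Y']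
  have "similar_ops (H_I \<eta> m d Y) mult_op (H_I \<eta>' m' d' Y') mult_op \<longleftrightarrow>
      similar_ops (sum_bergman \<eta> m d) mult_op (sum_bergman \<eta>' m' d') mult_op"
    using similar_ops_norm_equiv[OF equiv] similar_ops_norm_equiv[OF equiv[THEN norm_equiv_sym]]
    by blast
  also have "\<dots> \<longleftrightarrow> (m = m' \<and> (\<forall>j\<le>m. d j = d' j)) \<and> \<eta> = \<eta>'"
  proof
    assume "similar_ops (sum_bergman \<eta> m d) mult_op (sum_bergman \<eta>' m' d') mult_op"
    from similar_imp_level_cards_eq[OF assms(1,2) this]
    show "(m = m' \<and> (\<forall>j\<le>m. d j = d' j)) \<and> \<eta> = \<eta>'"
      by (rule level_cards_determine[OF assms(3,4)])
  next
    assume "(m = m' \<and> (\<forall>j\<le>m. d j = d' j)) \<and> \<eta> = \<eta>'"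
    then show "similar_ops (sum_bergman \<eta> m d) mult_op (sum_bergman \<eta>' m' d') mult_op"
      using similar_mult_op_refl[OF assms(1), of m d] sum_bergman_cong[of m d d' \<eta>] by simp
  qed
  finally show ?thesis .
qed

end
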